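(* Consider the alternating direction discrete gradient flow algorithm described in the context, with initial datum $(s_h^0,\mathbf\Theta_h^0,\mathbf U_h^0)\in\mathcal A^h_{\mathrm{uni}}(g_h,\mathbf R_h)$, $\mathbf\Theta_h^0=\mathbf n_h^0\otimes\mathbf n_h^0$ at the nodes, and time step $\tau>0$. If the meshes are weakly acute and $\tau\le C_0h^{d/2}$, with $C_0$ proportional to $E^h_{\mathrm{uni-t}}[s_h^0,\mathbf\Theta_h^0]^{-1/2}$ (i.e. $C_0=c\,E^h_{\mathrm{uni-t}}[s_h^0,\mathbf\Theta_h^0]^{-1/2}$ for a suitable constant $c>0$ depending only on $d$ and on the shape-regularity and quasi-uniformity constants of the meshes), then $$E^h_{\mathrm{uni-t}}[s_h^K,\mathbf\Theta_h^K]+\frac1{2\tau}\sum_{k=0}^{K-1}\Big(\|\mathbf t_h^k\|^2_{H^1_\omega(\Omega)}+\|s_h^{k+1}-s_h^k\|^2_{L^2(\Omega)}\Big)\le E^h_{\mathrm{uni-t}}[s_h^0,\mathbf\Theta_h^0]\qquad\forall K\ge1,$$ where, in the $k$-th term, $H^1_\omega(\Omega)$ carries the weighted norm with weight $\omega=(s_h^k)^2$. Therefore, the algorithm stops in a finite number of steps: given a tolerance $\varepsilon>0$, there exists $K=K_\varepsilon\ge1$ such that $$\frac1\tau\Big(\|\mathbf t_h^K\|^2_{H^1_\omega(\Omega)}+\|s_h^K-s_h^{K-1}\|^2_{L^2(\Omega)}\Big)<\varepsilon .$$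
   Context: **Discrete setting.** $d\ge2$, $\Omega\subset\mathbb R^d$ is a bounded polyhedral domain. $\mathcal T_h$ is a conforming, shape-regular, quasi-uniform simplicial triangulation of $\Omega$ of mesh size $h$, with nodes $x_1,\dots,x_N$, hat functions $\phi_i$ and Lagrange interpolation operator $I_h$; $k_{ij}:=-\int_\Omega\nabla\phi_i\cdot\nabla\phi_j\,dx$. Weakly acute means $k_{ij}\ge0$ for all $i\ne j$. $\mathbb S^{d-1}$ is the unit sphere and $\mathbb L^{d-1}=\{\mathbf n\otimes\mathbf n:\mathbf n\in\mathbb S^{d-1}\}$. $\mathbb S_h$ is the space of continuous piecewise affine functions on $\mathcal T_h$, $\mathbb U_h=[\mathbb S_h]^{d\times d}$, $\mathbb T_h=\{\mathbf\Theta_h\in\mathbb U_h:\mathbf\Theta_h(x_i)\in\mathbb L^{d-1}\ \forall i\}$. Matrices carry the Frobenius inner product $:$ and norm, and $\delta_{ij}v:=v(x_i)-v(x_j)$. **Boundary data.** $\Gamma_s$ and $\Gamma_{\mathbf\Theta}=\Gamma_{\mathbf U}$ are relatively open subsets of $\partial\Omega$. The data $(g,\mathbf M,\mathbf R)\in W^1_\infty(\mathbb R^d)\times[L^\infty(\mathbb R^d)]^{d\times d}\times[W^1_\infty(\mathbb R^d)]^{d\times d}$ satisfy $-\frac1{d-1}\le g\le1$, $\mathbf R=g\mathbf M$, $\mathbf M\in\mathbb L^{d-1}$ in a neighborhood of $\partial\Omega$, and for some $\delta_0>0$: $-\frac1{d-1}+\delta_0\le g\le1-\delta_0$ in $\Omega$,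 $g\ge\delta_0$ on $\partial\Omega$. With $g_h=I_hg$, $\mathbf R_h=I_h\mathbf R$, $\mathbf M_h=I_h\mathbf M$, the set $\mathcal A^h_{\mathrm{uni}}(g_h,\mathbf R_h)$ consists of all $(s_h,\mathbf\Theta_h,\mathbf U_h)\in\mathbb S_h\times\mathbb T_h\times\mathbb U_h$ with $s_h=g_h$ on $\Gamma_s$, $\mathbf\Theta_h=\mathbf M_h$ on $\Gamma_{\mathbf\Theta}$, $\mathbf U_h=\mathbf R_h$ on $\Gamma_{\mathbf U}$, $\mathbf U_h=I_h(s_h\mathbf\Theta_h)$ and $-\frac1{d-1}\le s_h\le1$. $\mathbb S_h(g_h)$ (resp. $\mathbb S_h(0)$) is the set of $s_h\in\mathbb S_h$ equal to $g_h$ (resp. $0$) on $\Gamma_s$. **Energies.** For $\mathbf\Theta_h\in\mathbb U_h$ let $$E^h_{\mathrm{uni-i}}[s_h,\mathbf\Theta_h]=\frac14\sum_{i,j=1}^Nk_{ij}\frac{s_h(x_i)^2+s_h(x_j)^2}2|\delta_{ij}\mathbf\Theta_h|^2,\qquad E^h_{\mathrm{uni-m}}[s_h,\mathbf\Theta_h]=\frac{d-1}{4d}\sum_{i,j=1}^Nk_{ij}(\delta_{ij}s_h)^2+E^h_{\mathrm{uni-i}}[s_h,\mathbf\Theta_h],$$ $E^h_{\mathrm{bulk}}[s_h]=\frac1{\eta_B}\int_\Omega\psi(s_h)\,dx$ and $E^h_{\mathrm{uni-t}}=E^h_{\mathrm{uni-m}}+E^h_{\mathrm{bulk}}$. Here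 $\eta_B>0$ and $\psi(s)=K_0+\frac A2\mathrm{tr}(\mathbf Q^2)-\frac B3\mathrm{tr}(\mathbf Q^3)+\frac C4(\mathrm{tr}(\mathbf Q^2))^2$ with $\mathbf Q=s(\mathbf n\otimes\mathbf n-\frac1d\mathbf I)$, $|\mathbf n|=1$ (independent of $\mathbf n$; a quartic polynomial in $s$), $A\le0$, $B,C>0$ ($A<0$ if $d=2$), and the constant $K_0$ chosen so that $\psi\ge0$. It is assumed that $\psi(s)\ge\psi(1-\delta_0)$ for $s\ge1-\delta_0$ and $\psi(s)\ge\psi(-\frac1{d-1}+\delta_0)$ for $s\le-\frac1{d-1}+\delta_0$. A splitting $\psi=\psi_c-\psi_e$ with $\psi_c,\psi_e$ convex and differentiable is fixed. **Weighted norm.** $\|\mathbf v\|_{H^1_\omega(\Omega)}=\big(\int_\Omega|\mathbf v|^2dx+\int_\Omega|\nabla\mathbf v|^2\omega\,dx\big)^{1/2}$, with $\omega=(s_h^k)^2$ when applied to $\mathbf t_h^k$. **Algorithm.** For $\mathbf n_h^k\in[\mathbb S_h]^d$ with $|\mathbf n_h^k(x_i)|=1$ at all nodes, let $\mathbb V_h(\mathbf n_h^k)=\{\mathbf v_h\in[\mathbb S_h]^d:\mathbf v_h(x_i)\cdot\mathbf n_h^k(x_i)=0\ \forall i\}$, and let $H^1_{\Gamma_{\mathbf\Theta}}(\Omega)$ be the functions in $H^1(\Omega)$ with zero trace on $\Gamma_{\mathbf\Theta}$. Products of discrete fields that define elements of $\mathbb U_h$ are understood through their nodal values. For $k\ge0$,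 with $\mathbf\Theta_h^k=\mathbf n_h^k\otimes\mathbf n_h^k$: 1. Find $\mathbf t_h^k\in\mathbb V_h(\mathbf n_h^k)\cap[H^1_{\Gamma_{\mathbf\Theta}}(\Omega)]^d$, with $\mathbf T_h^k=\mathbf n_h^k\otimes\mathbf t_h^k+\mathbf t_h^k\otimes\mathbf n_h^k$, such that $$\frac1\tau\int_\Omega\big(\mathbf t_h^k\cdot\mathbf v_h+\nabla\mathbf t_h^k:\nabla\mathbf v_h\,|s_h^k|^2\big)dx+\delta_{\mathbf\Theta_h}E^h_{\mathrm{uni-i}}[s_h^k,\mathbf\Theta_h^k+\mathbf T_h^k;\mathbf V_h]=0$$ for all $\mathbf V_h=\mathbf n_h^k\otimes\mathbf v_h+\mathbf v_h\otimes\mathbf n_h^k$ with $\mathbf v_h\in\mathbb V_h(\mathbf n_h^k)\cap[H^1_{\Gamma_{\mathbf\Theta}}(\Omega)]^d$. Here $\delta_{\mathbf\Theta_h}E[s,\mathbf\Theta;\mathbf V]$ is the first variation (directional derivative) in the second argument at $\mathbf\Theta$ in direction $\mathbf V$. 2. At each node set $\mathbf n_h^{k+1}(x_i)=\frac{\mathbf n_h^k(x_i)+\mathbf t_h^k(x_i)}{|\mathbf n_h^k(x_i)+\mathbf t_h^k(x_i)|}$ and $\mathbf\Theta_h^{k+1}(x_i)=\mathbf n_h^{k+1}(x_i)\otimes\mathbf n_h^{k+1}(x_i)$. 3. Find $s_h^{k+1}\in\mathbb S_h(g_h)$ such that for all $z_h\in\mathbb S_h(0)$ $$\frac1\tau\int_\Omega(s_h^{k+1}-s_h^k)z_h\,dx+\delta_{s_h}E^h_{\mathrm{uni-m}}[s_h^{k+1},\mathbf\Theta_h^{k+1};z_h]+\frac1{\eta_B}\int_\Omega\big(\psi_c'(s_h^{k+1})-\psi_e'(s_h^k)\big)z_h\,dx=0,$$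 where $\delta_{s_h}E^h_{\mathrm{uni-m}}[s,\mathbf\Theta;z]$ is the directional derivative in the first argument at $s$ in direction $z$. *)

theory Defs
  imports "HOL-Analysis.Analysis"
begin

definition partial :: "'d::finite \<Rightarrow> (real^'d \<Rightarrow> real) \<Rightarrow> real^'d \<Rightarrow> real" where
  "partial i f x = frechet_derivative f (at x) (axis i 1)"

definition grad :: "(real^'d::finite \<Rightarrow> real) \<Rightarrow> real^'d \<Rightarrow> real^'d" where
  "grad f x = (\<chi> i. partial i f x)"

primrec Ck :: "nat \<Rightarrow> (real^'d::finite \<Rightarrow> real) \<Rightarrow> bool" where
  "Ck 0 f \<longleftrightarrow> continuous_on UNIV f"
| "Ck (Suc k) f \<longleftrightarrow> (\<forall>x. f differentiable (at x)) \<and> (\<forall>i. Ck k (partial i f))"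

definition test_functions :: "(real^'d::finite \<Rightarrow> real) set" where
  "test_functions = {f. (\<forall>k. Ck k f) \<and> compact (closure {x. f x \<noteq> 0})}"

definition L_infty :: "(real^'d::finite \<Rightarrow> 'b::euclidean_space) set" where
  "L_infty = {f \<in> borel_measurable lebesgue. \<exists>B. AE x in lebesgue. norm (f x) \<le> B}"

definition W1_infty :: "(real^'d::finite \<Rightarrow> 'b::euclidean_space) set" where
  "W1_infty = {f \<in> L_infty. \<forall>i. \<exists>G \<in> L_infty. \<forall>\<phi> \<in> test_functions.
     (LINT x|lebesgue. partial i \<phi> x *\<^sub>R f x) = - (LINT x|lebesgue. \<phi> x *\<^sub>R G x)}"

definition polyhedral_domain :: "(real^'d::finite) set \<Rightarrow> bool" where
  "polyhedral_domain \<Omega> \<longleftrightarrow> open \<Omega> \<and> connected \<Omega> \<and> \<Omega> \<noteq> {} \<and> bounded \<Omega> \<and>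
     interior (closure \<Omega>) = \<Omega> \<and>
     (\<exists>\<P>. finite \<P> \<and> (\<forall>P\<in>\<P>. polytope P) \<and> closure \<Omega> = \<Union>\<P>)"

text \<open>Conformity (simplices intersect in common faces, possibly empty) is part of the
  library predicate \<^const>\<open>triangulation\<close>.\<close>

definition conforming_mesh :: "(real^'d::finite) set \<Rightarrow> (real^'d) set set \<Rightarrow> bool" where
  "conforming_mesh \<Omega> \<T> \<longleftrightarrow> triangulation \<T> \<and>
     (\<forall>T\<in>\<T>. int CARD('d) simplex T) \<and> \<Union>\<T> = closure \<Omega>"

definition mesh_size :: "(real^'d::finite) set set \<Rightarrow> real" where
  "mesh_size \<T> = Max (diameter ` \<T>)"

definition inradius :: "(real^'d::finite) set \<Rightarrow> real" where
  "inradius T = Sup {r. \<exists>x. ball x r \<subseteq> T}"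

definition shape_regular :: "real \<Rightarrow> (real^'d::finite) set set \<Rightarrow> bool" where
  "shape_regular \<sigma> \<T> \<longleftrightarrow> (\<forall>T\<in>\<T>. diameter T \<le> \<sigma> * inradius T)"

definition quasi_uniform :: "real \<Rightarrow> (real^'d::finite) set set \<Rightarrow> bool" where
  "quasi_uniform \<kappa> \<T> \<longleftrightarrow> (\<forall>T\<in>\<T>. mesh_size \<T> \<le> \<kappa> * diameter T)"

definition nodes :: "(real^'d::finite) set set \<Rightarrow> (real^'d) set" where
  "nodes \<T> = {x. \<exists>T\<in>\<T>. x extreme_point_of T}"

text \<open>Finite element functions are total functions whose values off the closed domain
  \<open>\<Union>\<T>\<close> are unconstrained; nothing below depends on those values.  At \<open>'b = real\<close>,
  \<open>'b = real^'d\<close> and \<open>'b = real^'d^'d\<close> the space below is the scalar space, its \<open>d\<close>-fold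
  and its \<open>d \<times> d\<close>-fold product.\<close>

definition fe_space :: "(real^'d::finite) set set \<Rightarrow> (real^'d \<Rightarrow> 'b::euclidean_space) set" where
  "fe_space \<T> = {u. continuous_on (\<Union>\<T>) u \<and>
     (\<forall>T\<in>\<T>. \<exists>L b. linear L \<and> (\<forall>x\<in>T. u x = L x + b))}"

text \<open>The choice below is unique on \<open>\<Union>\<T>\<close>.\<close>

definition hat :: "(real^'d::finite) set set \<Rightarrow> real^'d \<Rightarrow> real^'d \<Rightarrow> real" where
  "hat \<T> p = (SOME \<phi>. \<phi> \<in> fe_space \<T> \<and> (\<forall>q\<in>nodes \<T>. \<phi> q = (if q = p then 1 else 0)))"

definition interp :: "(real^'d::finite) set set \<Rightarrow> (real^'d \<Rightarrow> 'b::euclidean_space)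
    \<Rightarrow> real^'d \<Rightarrow> 'b" where
  "interp \<T> f x = (\<Sum>p\<in>nodes \<T>. hat \<T> p x *\<^sub>R f p)"

definition stiffness :: "(real^'d::finite) set \<Rightarrow> (real^'d) set set \<Rightarrow> real^'d \<Rightarrow> real^'d \<Rightarrow> real"
  where "stiffness \<Omega> \<T> p q = - (LINT x:\<Omega>|lebesgue. grad (hat \<T> p) x \<bullet> grad (hat \<T> q) x)"

definition weakly_acute :: "(real^'d::finite) set \<Rightarrow> (real^'d) set set \<Rightarrow> bool" where
  "weakly_acute \<Omega> \<T> \<longleftrightarrow> (\<forall>p\<in>nodes \<T>. \<forall>q\<in>nodes \<T>. p \<noteq> q \<longrightarrow> stiffness \<Omega> \<T> p q \<ge> 0)"

definition tensor :: "real^'d::finite \<Rightarrow> real^'d \<Rightarrow> real^'d^'d" (infixl "\<otimes>\<^sub>t" 75) where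
  "v \<otimes>\<^sub>t w = (\<chi> i j. v $ i * w $ j)"

definition line_fields :: "(real^'d::finite^'d) set" where
  "line_fields = {n \<otimes>\<^sub>t n | n. norm n = 1}"

definition line_fe_space :: "(real^'d::finite) set set \<Rightarrow> (real^'d \<Rightarrow> real^'d^'d) set" where
  "line_fe_space \<T> = {\<Theta> \<in> fe_space \<T>. \<forall>p\<in>nodes \<T>. \<Theta> p \<in> line_fields}"

text \<open>\<open>g\<close> and \<open>R\<close> are given by their continuous representatives, and \<open>M\<close> by a representative
  for which \<open>R = g M\<close> holds everywhere, so that nodal values make sense.\<close>

definition boundary_data :: "(real^'d::finite) set \<Rightarrow> real \<Rightarrow> (real^'d \<Rightarrow> real)
    \<Rightarrow> (real^'d \<Rightarrow> real^'d^'d) \<Rightarrow> (real^'d \<Rightarrow> real^'d^'d) \<Rightarrow> bool" where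
  "boundary_data \<Omega> \<delta>\<^sub>0 g M R \<longleftrightarrow>
     g \<in> W1_infty \<and> continuous_on UNIV g \<and> M \<in> L_infty \<and> R \<in> W1_infty \<and> continuous_on UNIV R \<and>
     (\<forall>x. - 1 / (real CARD('d) - 1) \<le> g x \<and> g x \<le> 1) \<and>
     (\<forall>x. R x = g x *\<^sub>R M x) \<and>
     (\<exists>U. open U \<and> frontier \<Omega> \<subseteq> U \<and> (\<forall>x\<in>U. M x \<in> line_fields)) \<and>
     \<delta>\<^sub>0 > 0 \<and>
     (\<forall>x\<in>\<Omega>. - 1 / (real CARD('d) - 1) + \<delta>\<^sub>0 \<le> g x \<and> g x \<le> 1 - \<delta>\<^sub>0) \<and>
     (\<forall>x\<in>frontier \<Omega>. g x \<ge> \<delta>\<^sub>0)"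

definition fe_space_bc :: "(real^'d::finite) set set \<Rightarrow> (real^'d) set
    \<Rightarrow> (real^'d \<Rightarrow> real) \<Rightarrow> (real^'d \<Rightarrow> real) set" where
  "fe_space_bc \<T> \<Gamma> w = {u \<in> fe_space \<T>. \<forall>x\<in>\<Gamma>. u x = w x}"

definition admissible :: "(real^'d::finite) set \<Rightarrow> (real^'d) set set \<Rightarrow> (real^'d) set
    \<Rightarrow> (real^'d) set \<Rightarrow> (real^'d \<Rightarrow> real) \<Rightarrow> (real^'d \<Rightarrow> real^'d^'d) \<Rightarrow> (real^'d \<Rightarrow> real^'d^'d)
    \<Rightarrow> ((real^'d \<Rightarrow> real) \<times> (real^'d \<Rightarrow> real^'d^'d) \<times> (real^'d \<Rightarrow> real^'d^'d)) set" where
  "admissible \<Omega> \<T> \<Gamma>\<^sub>s \<Gamma>\<^sub>\<Theta> g\<^sub>h M\<^sub>h R\<^sub>h = {(s, \<Theta>, U).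
     s \<in> fe_space \<T> \<and> \<Theta> \<in> line_fe_space \<T> \<and> U \<in> fe_space \<T> \<and>
     (\<forall>x\<in>\<Gamma>\<^sub>s. s x = g\<^sub>h x) \<and> (\<forall>x\<in>\<Gamma>\<^sub>\<Theta>. \<Theta> x = M\<^sub>h x) \<and> (\<forall>x\<in>\<Gamma>\<^sub>\<Theta>. U x = R\<^sub>h x) \<and>
     (\<forall>x\<in>closure \<Omega>. U x = interp \<T> (\<lambda>y. s y *\<^sub>R \<Theta> y) x) \<and>
     (\<forall>x\<in>closure \<Omega>. - 1 / (real CARD('d) - 1) \<le> s x \<and> s x \<le> 1)}"

text \<open>The norm of the type of square matrices is the Frobenius norm.\<close>

definition E_uni_i :: "(real^'d::finite) set \<Rightarrow> (real^'d) set set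
    \<Rightarrow> (real^'d \<Rightarrow> real) \<Rightarrow> (real^'d \<Rightarrow> real^'d^'d) \<Rightarrow> real" where
  "E_uni_i \<Omega> \<T> s \<Theta> = 1/4 * (\<Sum>p\<in>nodes \<T>. \<Sum>q\<in>nodes \<T>.
     stiffness \<Omega> \<T> p q * (((s p)\<^sup>2 + (s q)\<^sup>2) / 2) * (norm (\<Theta> p - \<Theta> q))\<^sup>2)"

definition E_uni_m :: "(real^'d::finite) set \<Rightarrow> (real^'d) set set
    \<Rightarrow> (real^'d \<Rightarrow> real) \<Rightarrow> (real^'d \<Rightarrow> real^'d^'d) \<Rightarrow> real" where
  "E_uni_m \<Omega> \<T> s \<Theta> = (real CARD('d) - 1) / (4 * real CARD('d)) *
     (\<Sum>p\<in>nodes \<T>. \<Sum>q\<in>nodes \<T>. stiffness \<Omega> \<T> p q * (s p - s q)\<^sup>2) + E_uni_i \<Omega> \<T> s \<Theta>"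

definition bulk_potential :: "real^'d::finite \<Rightarrow> real \<Rightarrow> real \<Rightarrow> real \<Rightarrow> real \<Rightarrow> real \<Rightarrow> real" where
  "bulk_potential e A B C K\<^sub>0 s =
     (let Q = s *\<^sub>R (e \<otimes>\<^sub>t e - (1 / real CARD('d)) *\<^sub>R mat 1) in
      K\<^sub>0 + A / 2 * trace (Q ** Q) - B / 3 * trace (Q ** Q ** Q) + C / 4 * (trace (Q ** Q))\<^sup>2)"

definition E_bulk :: "(real^'d::finite) set \<Rightarrow> real \<Rightarrow> (real \<Rightarrow> real) \<Rightarrow> (real^'d \<Rightarrow> real) \<Rightarrow> real"
  where "E_bulk \<Omega> \<eta>\<^sub>B \<psi> s = 1 / \<eta>\<^sub>B * (LINT x:\<Omega>|lebesgue. \<psi> (s x))"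

definition E_uni_t :: "(real^'d::finite) set \<Rightarrow> (real^'d) set set \<Rightarrow> real \<Rightarrow> (real \<Rightarrow> real)
    \<Rightarrow> (real^'d \<Rightarrow> real) \<Rightarrow> (real^'d \<Rightarrow> real^'d^'d) \<Rightarrow> real" where
  "E_uni_t \<Omega> \<T> \<eta>\<^sub>B \<psi> s \<Theta> = E_uni_m \<Omega> \<T> s \<Theta> + E_bulk \<Omega> \<eta>\<^sub>B \<psi> s"

definition var_Theta_E_uni_i :: "(real^'d::finite) set \<Rightarrow> (real^'d) set set \<Rightarrow> (real^'d \<Rightarrow> real)
    \<Rightarrow> (real^'d \<Rightarrow> real^'d^'d) \<Rightarrow> (real^'d \<Rightarrow> real^'d^'d) \<Rightarrow> real" where
  "var_Theta_E_uni_i \<Omega> \<T> s \<Theta> V = deriv (\<lambda>\<epsilon>. E_uni_i \<Omega> \<T> s (\<lambda>x. \<Theta> x + \<epsilon> *\<^sub>R V x)) 0"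

definition var_s_E_uni_m :: "(real^'d::finite) set \<Rightarrow> (real^'d) set set \<Rightarrow> (real^'d \<Rightarrow> real)
    \<Rightarrow> (real^'d \<Rightarrow> real^'d^'d) \<Rightarrow> (real^'d \<Rightarrow> real) \<Rightarrow> real" where
  "var_s_E_uni_m \<Omega> \<T> s \<Theta> z = deriv (\<lambda>\<epsilon>. E_uni_m \<Omega> \<T> (\<lambda>x. s x + \<epsilon> * z x) \<Theta>) 0"

definition L2_norm_on :: "(real^'d::finite) set \<Rightarrow> (real^'d \<Rightarrow> real) \<Rightarrow> real" where
  "L2_norm_on \<Omega> u = sqrt (LINT x:\<Omega>|lebesgue. (u x)\<^sup>2)"

definition H1_weighted_norm :: "(real^'d::finite) set \<Rightarrow> (real^'d \<Rightarrow> real)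
    \<Rightarrow> (real^'d \<Rightarrow> real^'d) \<Rightarrow> real" where
  "H1_weighted_norm \<Omega> \<omega> v = sqrt ((LINT x:\<Omega>|lebesgue. (norm (v x))\<^sup>2) +
     (LINT x:\<Omega>|lebesgue. (norm (jacobian v (at x)))\<^sup>2 * \<omega> x))"

text \<open>Vanishing trace on \<open>\<Gamma>\<close> is vanishing on \<open>\<Gamma>\<close> for functions that are continuous up to the
  boundary.\<close>

definition tangent_space :: "(real^'d::finite) set set \<Rightarrow> (real^'d) set \<Rightarrow> (real^'d \<Rightarrow> real^'d)
    \<Rightarrow> (real^'d \<Rightarrow> real^'d) set" where
  "tangent_space \<T> \<Gamma> n = {v \<in> fe_space \<T>. (\<forall>p\<in>nodes \<T>. v p \<bullet> n p = 0) \<and> (\<forall>x\<in>\<Gamma>. v x = 0)}"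

definition tangent_field :: "(real^'d::finite) set set \<Rightarrow> (real^'d \<Rightarrow> real^'d)
    \<Rightarrow> (real^'d \<Rightarrow> real^'d) \<Rightarrow> real^'d \<Rightarrow> real^'d^'d" where
  "tangent_field \<T> n v = interp \<T> (\<lambda>x. n x \<otimes>\<^sub>t v x + v x \<otimes>\<^sub>t n x)"

definition tangent_step :: "(real^'d::finite) set \<Rightarrow> (real^'d) set set \<Rightarrow> (real^'d) set \<Rightarrow> real
    \<Rightarrow> (real^'d \<Rightarrow> real) \<Rightarrow> (real^'d \<Rightarrow> real^'d^'d) \<Rightarrow> (real^'d \<Rightarrow> real^'d)
    \<Rightarrow> (real^'d \<Rightarrow> real^'d) \<Rightarrow> bool" where
  "tangent_step \<Omega> \<T> \<Gamma>\<^sub>\<Theta> \<tau> s \<Theta> n t \<longleftrightarrow> t \<in> tangent_space \<T> \<Gamma>\<^sub>\<Theta> n \<and>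
     (\<forall>v \<in> tangent_space \<T> \<Gamma>\<^sub>\<Theta> n.
        1 / \<tau> * (LINT x:\<Omega>|lebesgue. t x \<bullet> v x +
            (jacobian t (at x) \<bullet> jacobian v (at x)) * \<bar>s x\<bar>\<^sup>2) +
        var_Theta_E_uni_i \<Omega> \<T> s (\<lambda>x. \<Theta> x + tangent_field \<T> n t x) (tangent_field \<T> n v) = 0)"

definition order_step :: "(real^'d::finite) set \<Rightarrow> (real^'d) set set \<Rightarrow> (real^'d) set \<Rightarrow> real
    \<Rightarrow> real \<Rightarrow> (real \<Rightarrow> real) \<Rightarrow> (real \<Rightarrow> real) \<Rightarrow> (real^'d \<Rightarrow> real) \<Rightarrow> (real^'d \<Rightarrow> real)
    \<Rightarrow> (real^'d \<Rightarrow> real^'d^'d) \<Rightarrow> (real^'d \<Rightarrow> real) \<Rightarrow> bool" where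
  "order_step \<Omega> \<T> \<Gamma>\<^sub>s \<tau> \<eta>\<^sub>B \<psi>\<^sub>c \<psi>\<^sub>e g\<^sub>h s \<Theta>' s' \<longleftrightarrow> s' \<in> fe_space_bc \<T> \<Gamma>\<^sub>s g\<^sub>h \<and>
     (\<forall>z \<in> fe_space_bc \<T> \<Gamma>\<^sub>s (\<lambda>x. 0).
        1 / \<tau> * (LINT x:\<Omega>|lebesgue. (s' x - s x) * z x) +
        var_s_E_uni_m \<Omega> \<T> s' \<Theta>' z +
        1 / \<eta>\<^sub>B * (LINT x:\<Omega>|lebesgue. (deriv \<psi>\<^sub>c (s' x) - deriv \<psi>\<^sub>e (s x)) * z x) = 0)"

definition gradient_flow :: "(real^'d::finite) set \<Rightarrow> (real^'d) set set \<Rightarrow> (real^'d) set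
    \<Rightarrow> (real^'d) set \<Rightarrow> real \<Rightarrow> real \<Rightarrow> (real \<Rightarrow> real) \<Rightarrow> (real \<Rightarrow> real) \<Rightarrow> (real^'d \<Rightarrow> real)
    \<Rightarrow> (nat \<Rightarrow> real^'d \<Rightarrow> real) \<Rightarrow> (nat \<Rightarrow> real^'d \<Rightarrow> real^'d^'d) \<Rightarrow> (nat \<Rightarrow> real^'d \<Rightarrow> real^'d)
    \<Rightarrow> (nat \<Rightarrow> real^'d \<Rightarrow> real^'d) \<Rightarrow> bool" where
  "gradient_flow \<Omega> \<T> \<Gamma>\<^sub>s \<Gamma>\<^sub>\<Theta> \<tau> \<eta>\<^sub>B \<psi>\<^sub>c \<psi>\<^sub>e g\<^sub>h s \<Theta> n t \<longleftrightarrow> (\<forall>k.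
     n k \<in> fe_space \<T> \<and> (\<forall>p\<in>nodes \<T>. norm (n k p) = 1) \<and>
     \<Theta> k \<in> fe_space \<T> \<and> (\<forall>p\<in>nodes \<T>. \<Theta> k p = n k p \<otimes>\<^sub>t n k p) \<and>
     tangent_step \<Omega> \<T> \<Gamma>\<^sub>\<Theta> \<tau> (s k) (\<Theta> k) (n k) (t k) \<and>
     (\<forall>p\<in>nodes \<T>. n (Suc k) p = (n k p + t k p) /\<^sub>R norm (n k p + t k p)) \<and>
     order_step \<Omega> \<T> \<Gamma>\<^sub>s \<tau> \<eta>\<^sub>B \<psi>\<^sub>c \<psi>\<^sub>e g\<^sub>h (s k) (\<Theta> (Suc k)) (s (Suc k)))"

end

theory Submission
  imports Defs
begin

text \<open>
  Both half steps of the algorithm decrease the energy, and the decrease controls the squared norm of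
  the increment divided by \<open>2 * \<tau>\<close>.  The law is the telescoped sum of these estimates, and the
  stopping criterion follows since the energy is nonnegative, so that the dissipation is summable.

  The step for the order parameter is unconditionally stable.  The energy \<open>E_uni_m\<close> is a nonnegative
  quadratic form in \<open>s\<close> and is treated implicitly; the convex part of the bulk potential is implicit
  and the concave part explicit, so that the increment as a test function yields the decrease
  (\<open>order_step_energy_decay\<close>).

  The director step is first solved in the tangent space, where the quadratic energy \<open>E_uni_i\<close> decreases
  for the same reason, and then projected back to unit vectors.  The projection normalises
  the matrix \<open>(n + t) \<otimes> (n + t)\<close>, from which the linearised update differs by the quadratic term
  \<open>t \<otimes> t\<close>.  Weak acuteness makes the energy monotone in nodal differences, so the projection
  itself, which contracts distances outside the unit ball, is harmless.  What remains is the quadratic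
  term, whose energy is estimated by the inverse inequality \<open>E_uni_i_square_le\<close>:
  \<open>E (t \<otimes> t) \<le> C / h ^ d * N\<^sup>2\<close>, where \<open>N\<close> is the squared weighted norm of \<open>t\<close>.  Since both
  \<open>N / \<tau>\<close> and the energy are bounded by the initial energy \<open>E\<^sub>0\<close>, the quadratic term is absorbed by
  half of the dissipation \<open>N / \<tau>\<close> once \<open>\<tau>\<^sup>2 * E\<^sub>0 \<le> h ^ d / (25 * C)\<close>, which is the condition
  on the time step (\<open>director_step_energy_decay\<close>).

  The inverse inequality has to respect the degenerate weight \<open>s\<^sup>2\<close>.  It rests on two facts about affine
  functions on a simplex: they are comparable in mean square to their maximum
  (\<open>affine_norm_sq_le_mean_square\<close>), and hat functions have slope at most the reciprocal of the inradius
  (\<open>inradius_gradient_le_1\<close>).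
\<close>

section \<open>Rank-one matrices and normalisation\<close>

lemma norm_tensor: "norm (v \<otimes>\<^sub>t w) = norm v * norm w"
proof -
  have "v \<otimes>\<^sub>t w = (\<chi> i. v $ i *\<^sub>R w)"
    by (simp add: tensor_def vec_eq_iff)
  then show ?thesis
    by (simp add: norm_vec_def[where 'a="real^'a"] norm_vec_def[of v] L2_set_left_distrib)
qed

lemma tensor_algebra:
  "(v + w) \<otimes>\<^sub>t u = v \<otimes>\<^sub>t u + w \<otimes>\<^sub>t u" "u \<otimes>\<^sub>t (v + w) = u \<otimes>\<^sub>t v + u \<otimes>\<^sub>t w"
  "(v - w) \<otimes>\<^sub>t u = v \<otimes>\<^sub>t u - w \<otimes>\<^sub>t u" "u \<otimes>\<^sub>t (v - w) = u \<otimes>\<^sub>t v - u \<otimes>\<^sub>t w"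
  "(a *\<^sub>R v) \<otimes>\<^sub>t u = a *\<^sub>R (v \<otimes>\<^sub>t u)" "u \<otimes>\<^sub>t (a *\<^sub>R v) = a *\<^sub>R (u \<otimes>\<^sub>t v)"
  by (simp_all add: tensor_def vec_eq_iff algebra_simps)

lemma norm_tensor_diff_le:
  assumes "norm v \<le> M" "norm w \<le> M"
  shows "norm (v \<otimes>\<^sub>t v - w \<otimes>\<^sub>t w) \<le> 2 * M * norm (v - w)"
proof -
  have "v \<otimes>\<^sub>t v - w \<otimes>\<^sub>t w = v \<otimes>\<^sub>t (v - w) + (v - w) \<otimes>\<^sub>t w"
    by (simp add: tensor_algebra)
  also have "norm \<dots> \<le> norm v * norm (v - w) + norm (v - w) * norm w"
    by (metis norm_tensor norm_triangle_ineq)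
  also have "\<dots> \<le> M * norm (v - w) + norm (v - w) * M"
    using assms by (intro add_mono mult_mono) (auto intro: order_trans[OF norm_ge_zero])
  finally show ?thesis by simp
qed

lemma norm_matrix_vector_le:
  fixes A :: "real^'n::finite^'m::finite"
  shows "norm (A *v x) \<le> norm A * norm x"
proof -
  have "norm (A *v x) = L2_set (\<lambda>i. norm (A $ i \<bullet> x)) UNIV"
    by (simp add: norm_vec_def matrix_vector_mul_component)
  also have "\<dots> \<le> L2_set (\<lambda>i. norm (A $ i) * norm x) UNIV"
    by (intro L2_set_mono) (auto simp: Cauchy_Schwarz_ineq2)
  also have "\<dots> = norm A * norm x"
    by (simp add: norm_vec_def[of A] L2_set_left_distrib)
  finally show ?thesis .
qed

text \<open>Radial projection onto the unit sphere does not increase distances between points that lie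
  outside the open unit ball.  It is applied to rank-one matrices, for which normalising the matrix
  and normalising the generating vector amount to the same.\<close>

lemma norm_normalize_diff_le:
  fixes x y :: "'a::real_inner"
  assumes "norm x \<ge> 1" "norm y \<ge> 1"
  shows "norm (x /\<^sub>R norm x - y /\<^sub>R norm y) \<le> norm (x - y)"
proof -
  define a b where "a = norm x" and "b = norm y"
  have ab: "a \<ge> 1" "b \<ge> 1" using assms by (auto simp: a_def b_def)
  have sq: "x \<bullet> x = a\<^sup>2" "y \<bullet> y = b\<^sup>2"
    by (auto simp: a_def b_def power2_norm_eq_inner)
  have cs: "x \<bullet> y \<le> a * b"
    unfolding a_def b_def by (rule norm_cauchy_schwarz)
  have "(norm (x /\<^sub>R a - y /\<^sub>R b))\<^sup>2 = 2 - 2 * (x \<bullet> y) / (a * b)"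
    using ab unfolding power2_norm_eq_inner
    by (simp add: inner_diff_left inner_diff_right sq inner_commute[of y x] divide_simps power2_eq_square)
  also have "\<dots> = (2 * (a * b) - 2 * (x \<bullet> y)) / (a * b)"
    using ab by (simp add: field_simps)
  also have "\<dots> \<le> (2 * (a * b) - 2 * (x \<bullet> y)) / 1"
    using ab cs mult_mono[of 1 a 1 b] by (intro divide_left_mono) auto
  also have "\<dots> \<le> a\<^sup>2 + b\<^sup>2 - 2 * (x \<bullet> y)"
    using sum_squares_bound[of a b] by simp
  also have "\<dots> = (norm (x - y))\<^sup>2"
    by (simp add: power2_norm_eq_inner inner_diff_left inner_diff_right sq inner_commute)
  finally show ?thesis
    unfolding a_def b_def by (rule power2_le_imp_le) simp
qed

section \<open>Affine functions on convex bodies\<close>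

lemma set_integrable_continuous_compact:
  fixes f :: "'a::euclidean_space \<Rightarrow> 'b::euclidean_space"
  assumes "compact S" "continuous_on S f"
  shows "set_integrable lebesgue S f"
  using borel_integrable_compact[OF assms] unfolding set_integrable_def
  by (rule integrable_completion[THEN iffD2, rotated])
     (use borel_integrable_compact[OF assms] in auto)

lemma set_integral_subset_le:
  fixes f :: "'a \<Rightarrow> real"
  assumes "set_integrable M T f" "S \<in> sets M" "S \<subseteq> T" "\<And>x. x \<in> T \<Longrightarrow> 0 \<le> f x"
  shows "(LINT x:S|M. f x) \<le> (LINT x:T|M. f x)"
  unfolding set_lebesgue_integral_def
  using set_integrable_subset[OF assms(1-3)] assms unfolding set_integrable_def
  by (intro integral_mono) (auto split: split_indicator)

lemma integral_interior_convex:
  fixes f :: "'a::euclidean_space \<Rightarrow> 'b::euclidean_space"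
  assumes "convex S" "compact S" "continuous_on S f"
  shows "(LINT x:interior S|lebesgue. f x) = (LINT x:S|lebesgue. f x)"
proof (rule set_integral_cong_set)
  show S: "set_borel_measurable lebesgue S f"
    using set_integrable_continuous_compact[OF assms(2,3)]
    by (auto simp: set_borel_measurable_def set_integrable_def)
  show "set_borel_measurable lebesgue (interior S) f"
    by (rule set_borel_measurable_subset[OF S]) (auto simp: interior_subset)
  have "negligible (frontier S)"
    using assms by (rule_tac negligible_convex_frontier)
  then have "AE x in lebesgue. x \<notin> frontier S"
    by (simp add: AE_not_in negligible_iff_null_sets)
  then show "AE x in lebesgue. (x \<in> S) = (x \<in> interior S)"
    using assms(2) interior_subset[of S]
    by (auto simp: frontier_def compact_imp_closed)
qed

text \<open>An affine function cannot be much smaller in mean square than at a single point.  Shrink the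
  convex body \<open>T\<close> by the factor \<open>1/4\<close> towards a point \<open>p\<close> where \<open>norm u\<close> is maximal.  On the
  shrunken copy, \<open>u\<close> is a convex combination of \<open>u p\<close>, with weight \<open>3/4\<close>, and of another value
  of \<open>u\<close> on \<open>T\<close>; so its norm is at least half the maximum there, and the copy has \<open>4 ^ (-DIM('a))\<close>
  times the measure of \<open>T\<close>.\<close>

lemma affine_norm_sq_le_mean_square:
  fixes u :: "'a::euclidean_space \<Rightarrow> 'b::euclidean_space"
  assumes "compact T" "convex T" "linear L" and u: "\<And>x. x \<in> T \<Longrightarrow> u x = L x + b" and "x \<in> T"
  shows "(norm (u x))\<^sup>2 * measure lebesgue T
    \<le> 4 ^ (DIM('a) + 1) * (LINT y:interior T|lebesgue. (norm (u y))\<^sup>2)"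
proof -
  let ?d = "DIM('a)"
  have cont: "continuous_on T u"
    using continuous_on_add[OF linear_continuous_on[of L T] continuous_on_const[of T b]] \<open>linear L\<close> u
    by (simp add: linear_conv_bounded_linear cong: continuous_on_cong)
  have int: "set_integrable lebesgue T (\<lambda>y. (norm (u y))\<^sup>2)"
    by (intro set_integrable_continuous_compact continuous_intros cont assms)
  obtain p where p: "p \<in> T" "\<And>y. y \<in> T \<Longrightarrow> norm (u y) \<le> norm (u p)"
    using continuous_attains_sup[of T "\<lambda>y. norm (u y)"] assms(1,5) cont continuous_on_norm by blast
  define S where "S = (\<lambda>y. (1/4) *\<^sub>R y + (3/4) *\<^sub>R p) ` T"
  have ST: "S \<subseteq> T"
    using p(1) assms(2) by (auto simp: S_def convex_def)
  have cS: "compact S" unfolding S_def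
    by (intro compact_continuous_image continuous_intros assms)
  have mS: "measure lebesgue S = measure lebesgue T / 4 ^ ?d"
    unfolding S_def using measure_lebesgue_affine[of "1/4" "(3/4) *\<^sub>R p" T]
    by (simp add: field_simps)
  have low: "(norm (u p))\<^sup>2 / 4 \<le> (norm (u y))\<^sup>2" if "y \<in> S" for y
  proof -
    obtain z where z: "z \<in> T" "y = (1/4) *\<^sub>R z + (3/4) *\<^sub>R p" using \<open>y \<in> S\<close> by (auto simp: S_def)
    have "u y = (1/4) *\<^sub>R u z + (3/4) *\<^sub>R u p"
      using ST \<open>y \<in> S\<close> z p(1) u \<open>linear L\<close>
      by (simp add: subset_iff linear_add linear_scale algebra_simps flip: scaleR_add_left)
    then have "norm (u y) \<ge> norm ((3/4) *\<^sub>R u p) - norm ((1/4) *\<^sub>R u z)"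
      by (metis add.commute norm_diff_ineq)
    also have "norm ((3/4) *\<^sub>R u p) - norm ((1/4) *\<^sub>R u z) \<ge> norm (u p) / 2"
      using p(2)[OF z(1)] by simp
    finally have "(norm (u p) / 2)\<^sup>2 \<le> (norm (u y))\<^sup>2"
      by (intro power_mono) auto
    then show ?thesis by (simp add: power_divide)
  qed
  have "(norm (u x))\<^sup>2 * measure lebesgue T \<le> (norm (u p))\<^sup>2 * measure lebesgue T"
    using p(2)[OF assms(5)] by (intro mult_right_mono power_mono) auto
  also have "\<dots> = 4 ^ (?d + 1) * (LINT y:S|lebesgue. (norm (u p))\<^sup>2 / 4)"
    using mS lmeasurable_compact[OF cS]
    by (subst set_integral_const) (auto simp: fmeasurable_def)
  also have "(LINT y:S|lebesgue. (norm (u p))\<^sup>2 / 4) \<le> (LINT y:S|lebesgue. (norm (u y))\<^sup>2)"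
    by (intro set_integral_mono set_integrable_continuous_compact cS continuous_intros low
        continuous_on_subset[OF cont ST])
  also have "\<dots> \<le> (LINT y:T|lebesgue. (norm (u y))\<^sup>2)"
    using ST lmeasurable_compact[OF cS] int by (intro set_integral_subset_le) (auto simp: fmeasurableD)
  also have "\<dots> = (LINT y:interior T|lebesgue. (norm (u y))\<^sup>2)"
    by (intro integral_interior_convex[symmetric] continuous_intros cont assms)
  finally show ?thesis by simp
qed

text \<open>Balls of negative radius are empty, hence contained in every set.\<close>

lemma inradius_set_nonempty: "{r. \<exists>x. ball x r \<subseteq> (T :: 'a::metric_space set)} \<noteq> {}"
proof -
  have "ball (undefined::'a) (-1) \<subseteq> T" by (simp add: ball_empty)
  then show ?thesis by blast
qed

lemma inradius_set_bdd_above: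
  assumes "bounded (T :: (real^'d::finite) set)"
  shows "bdd_above {r. \<exists>x. ball x r \<subseteq> T}"
proof (rule bdd_aboveI)
  fix r assume "r \<in> {r. \<exists>x. ball x r \<subseteq> T}"
  then obtain x where x: "ball x r \<subseteq> T" by blast
  show "r \<le> diameter T"
  proof (cases "r > 0")
    case True
    have "diameter (ball x r) = 2 * r" using True diameter_ball[of x r] by simp
    then show ?thesis using diameter_subset[OF x assms] True by simp
  qed (use diameter_ge_0[OF assms] in auto)
qed

lemma inradius_pos:
  assumes "bounded T" "interior T \<noteq> {}"
  shows "inradius T > 0"
proof -
  obtain x e where "e > 0" "ball x e \<subseteq> T"
    using assms(2) mem_interior by blast
  then show ?thesis
    unfolding inradius_def
    using cSup_upper[OF _ inradius_set_bdd_above[OF assms(1)], of e] by force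
qed

text \<open>Across an inscribed ball of radius \<open>r\<close>, the affine function grows by \<open>r * norm g\<close> from the
  centre to the boundary in the direction of its gradient, but its values stay in \<open>{0..1}\<close>.\<close>

lemma inradius_gradient_le_1:
  assumes "\<And>x. x \<in> T \<Longrightarrow> 0 \<le> g \<bullet> x + b \<and> g \<bullet> x + b \<le> (1::real)"
  shows "inradius T * norm g \<le> 1"
proof (cases "g = 0")
  case False
  have "inradius T \<le> 1 / norm g"
    unfolding inradius_def
  proof (rule cSup_least[OF inradius_set_nonempty])
    fix r assume "r \<in> {r. \<exists>x. ball x r \<subseteq> T}"
    then obtain x where x: "ball x r \<subseteq> T" by blast
    have "\<rho> \<le> 1 / norm g" if "0 < \<rho>" "\<rho> < r" for \<rho>
    proof -
      define y where "y = x + (\<rho> / norm g) *\<^sub>R g"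
      have "dist x y = \<rho>" using False \<open>0 < \<rho>\<close> by (simp add: y_def dist_norm)
      then have "x \<in> ball x r" "y \<in> ball x r" using that by simp_all
      then have "x \<in> T" "y \<in> T" using x by blast+
      then have "g \<bullet> y - g \<bullet> x \<le> 1" using assms by (smt (verit))
      moreover have "g \<bullet> y - g \<bullet> x = \<rho> * norm g"
        using False by (simp add: y_def inner_add_right flip: power2_norm_eq_inner)
          (simp add: power2_eq_square)
      ultimately show ?thesis using False by (simp add: field_simps)
    qed
    show "r \<le> 1 / norm g"
    proof (cases "0 < r")
      case True
      then show ?thesis using dense_le_bounded[of 0 r] \<open>\<And>\<rho>. _ \<Longrightarrow> _ \<Longrightarrow> \<rho> \<le> 1 / norm g\<close> by blast
    next
      case False
      then show ?thesis by (rule_tac order_trans[of _ 0]) simp_all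
    qed
  qed
  then show ?thesis using False by (simp add: field_simps)
qed auto

lemma measure_ge_inradius_power:
  assumes "compact (T :: (real^'d::finite) set)" "inradius T > 0"
  shows "(inradius T / 2) ^ CARD('d) * measure lebesgue (ball (0::real^'d) 1) \<le> measure lebesgue T"
proof -
  have "inradius T / 2 < Sup {r. \<exists>x. ball x r \<subseteq> T}"
    using assms by (simp add: inradius_def[symmetric])
  then obtain r x where r: "inradius T / 2 < r" "ball x r \<subseteq> T"
    using less_cSupD[OF inradius_set_nonempty] by blast
  have "(inradius T / 2) ^ CARD('d) * measure lebesgue (ball (0::real^'d) 1)
      \<le> r ^ CARD('d) * measure lebesgue (ball (0::real^'d) 1)"
    using r assms by (intro mult_right_mono power_mono) auto
  also have "\<dots> = measure lebesgue (ball x r)"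
    using content_ball_conv_unit_ball[of r x] r assms by simp
  also have "\<dots> \<le> measure lebesgue T"
    using r lmeasurable_compact[OF assms(1)] by (intro measure_mono_fmeasurable) auto
  finally show ?thesis .
qed

section \<open>Simplicial meshes and their nodal bases\<close>

lemma affine_interpolation_exists:
  fixes f :: "'a::euclidean_space \<Rightarrow> 'b::euclidean_space"
  assumes "\<not> affine_dependent V"
  shows "\<exists>L b. linear L \<and> (\<forall>p\<in>V. L p + b = f p)"
proof (cases "V = {}")
  case False
  then obtain a where a: "a \<in> V" by blast
  define B where "B = (\<lambda>x. x - a) ` (V - {a})"
  have "independent B"
    using assms affine_dependent_iff_dependent2[OF a] by (simp add: B_def)
  then obtain L where L: "linear L" "\<And>x. x \<in> B \<Longrightarrow> L x = f (x + a) - f a"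
    using linear_independent_extend[of B "\<lambda>x. f (x + a) - f a"] by blast
  have "L p + (f a - L a) = f p" if "p \<in> V" for p
  proof (cases "p = a")
    case False
    then have "L (p - a) = f p - f a" using L(2)[of "p - a"] that by (simp add: B_def)
    then show ?thesis by (simp add: linear_diff[OF L(1)] algebra_simps)
  qed simp
  then show ?thesis using L(1) by blast
qed (use linear_zero in auto)

lemma affine_in_convex_on_hull:
  assumes "linear L" "convex C" "\<And>p. p \<in> V \<Longrightarrow> L p + b \<in> C" "x \<in> convex hull V"
  shows "L x + b \<in> C"
proof -
  have "L (u *\<^sub>R x + v *\<^sub>R y) + b = u *\<^sub>R (L x + b) + v *\<^sub>R (L y + b)" if "u + v = 1" for u v x y
  proof -
    have "b = u *\<^sub>R b + v *\<^sub>R b" using that by (metis scaleR_left_distrib scaleR_one)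
    then show ?thesis
      by (simp add: linear_add[OF \<open>linear L\<close>] linear_scale[OF \<open>linear L\<close>] scaleR_right_distrib)
  qed
  then have "convex {x. L x + b \<in> C}"
    using assms(2) by (simp add: convex_def)
  then have "convex hull V \<subseteq> {x. L x + b \<in> C}"
    using assms(3) by (intro hull_minimal) auto
  then show ?thesis using assms(4) by blast
qed

lemma affine_eq_on_hull:
  assumes "linear L" "linear L'" "\<And>p. p \<in> V \<Longrightarrow> L p + b = L' p + b'" "x \<in> convex hull V"
  shows "L x + b = L' x + b'"
proof -
  have "linear (\<lambda>x. L x - L' x)" using assms(1,2) by (rule linear_compose_sub)
  from affine_in_convex_on_hull[OF this convex_singleton[of 0], of V "b - b'" x]
  show ?thesis using assms(3,4) by (simp add: algebra_simps)
qed

locale simplicial_mesh =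
  fixes \<Omega> :: "(real^'d::finite) set" and \<T> :: "(real^'d) set set"
  assumes domain: "polyhedral_domain \<Omega>" and mesh: "conforming_mesh \<Omega> \<T>"
begin

lemma finite_mesh: "finite \<T>"
  and Union_mesh: "\<Union>\<T> = closure \<Omega>"
  and face_mesh: "\<lbrakk>T \<in> \<T>; T' \<in> \<T>\<rbrakk> \<Longrightarrow> T \<inter> T' face_of T"
  using mesh by (auto simp: conforming_mesh_def triangulation_def)

lemma mesh_nonempty: "\<T> \<noteq> {}"
  using domain Union_mesh by (auto simp: polyhedral_domain_def)

lemma open_domain: "open \<Omega>" "bounded \<Omega>" "interior (closure \<Omega>) = \<Omega>"
  using domain by (auto simp: polyhedral_domain_def)

lemma vertices_simplex:
  assumes "T \<in> \<T>"
  obtains V where "\<not> affine_dependent V" "card V = CARD('d) + 1" "T = convex hull V"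
    "V = {p. p extreme_point_of T}"
proof -
  have "int CARD('d) simplex T" using assms mesh by (simp add: conforming_mesh_def)
  then obtain V where "\<not> affine_dependent V" "int (card V) = int CARD('d) + 1" "T = convex hull V"
    unfolding simplex_def by blast
  then show thesis using that extreme_point_of_convex_hull_affine_independent by fastforce
qed

text \<open>A node is a vertex of some simplex \<open>T'\<close>.  If it also lies in \<open>T\<close>, then it is an extreme
  point of the common face \<open>T \<inter> T'\<close>, hence of \<open>T\<close>: conformity rules out hanging nodes.\<close>

lemma extreme_point_iff_node:
  assumes "T \<in> \<T>"
  shows "p extreme_point_of T \<longleftrightarrow> p \<in> nodes \<T> \<and> p \<in> T"
proof
  assume "p \<in> nodes \<T> \<and> p \<in> T"
  then obtain T' where T': "T' \<in> \<T>" "p extreme_point_of T'" "p \<in> T" by (auto simp: nodes_def)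
  then have "p extreme_point_of (T' \<inter> T)"
    using extreme_point_of_face[OF face_mesh[OF T'(1) assms]] by (auto simp: extreme_point_of_def)
  then show "p extreme_point_of T"
    using extreme_point_of_face[OF face_mesh[OF assms T'(1)]] by (simp add: Int_commute)
qed (use assms in \<open>auto simp: nodes_def extreme_point_of_def\<close>)

lemma
  assumes "T \<in> \<T>"
  shows independent_nodes: "\<not> affine_dependent (nodes \<T> \<inter> T)"
    and card_nodes: "card (nodes \<T> \<inter> T) = CARD('d) + 1"
    and hull_nodes: "convex hull (nodes \<T> \<inter> T) = T"
proof -
  obtain V where V: "\<not> affine_dependent V" "card V = CARD('d) + 1" "T = convex hull V"
    "V = {p. p extreme_point_of T}" by (rule vertices_simplex[OF assms])
  have Veq: "nodes \<T> \<inter> T = V"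
    unfolding V(4) using extreme_point_iff_node[OF assms] by blast
  show "\<not> affine_dependent (nodes \<T> \<inter> T)" unfolding Veq by (rule V(1))
  show "card (nodes \<T> \<inter> T) = CARD('d) + 1" unfolding Veq by (rule V(2))
  show "convex hull (nodes \<T> \<inter> T) = T" unfolding Veq by (rule V(3)[symmetric])
qed

lemma finite_element_nodes: "T \<in> \<T> \<Longrightarrow> finite (nodes \<T> \<inter> T)"
  using card_nodes[of T] by (intro card_ge_0_finite) auto

lemma node_element:
  assumes "p \<in> nodes \<T>"
  obtains T where "T \<in> \<T>" "p \<in> T"
  using assms by (auto simp: nodes_def extreme_point_of_def)

lemma finite_nodes: "finite (nodes \<T>)"
proof -
  have "nodes \<T> = (\<Union>T\<in>\<T>. nodes \<T> \<inter> T)" by (auto elim: node_element)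
  moreover have "finite (\<Union>T\<in>\<T>. nodes \<T> \<inter> T)"
    by (intro finite_UN_I finite_mesh finite_element_nodes)
  ultimately show ?thesis by simp
qed

lemma compact_element: "T \<in> \<T> \<Longrightarrow> compact T"
  by (metis hull_nodes finite_element_nodes finite_imp_compact_convex_hull)

lemma convex_element: "T \<in> \<T> \<Longrightarrow> convex T"
  by (metis hull_nodes convex_convex_hull)

lemma interior_element: "T \<in> \<T> \<Longrightarrow> interior T \<noteq> {}"
  using interior_convex_hull_eq_empty[of "nodes \<T> \<inter> T"] card_nodes independent_nodes hull_nodes
  by fastforce

lemma inradius_element_pos: "T \<in> \<T> \<Longrightarrow> 0 < inradius T"
  by (intro inradius_pos compact_imp_bounded compact_element interior_element)

lemma diameter_element_pos:
  assumes "T \<in> \<T>" shows "0 < diameter T"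
proof -
  obtain x e where e: "e > 0" "cball x e \<subseteq> T"
    using interior_element[OF assms] mem_interior_cball by blast
  have "2 * e \<le> diameter T"
    using diameter_subset[OF e(2) compact_imp_bounded[OF compact_element[OF assms]]] e(1)
    by (simp add: diameter_cball)
  then show ?thesis using e(1) by simp
qed

lemma fe_space_affine:
  assumes "u \<in> fe_space \<T>" "T \<in> \<T>"
  obtains L b where "linear L" "\<And>x. x \<in> T \<Longrightarrow> u x = L x + b"
  using assms by (auto simp: fe_space_def)

lemma fe_space_continuous: "u \<in> fe_space \<T> \<Longrightarrow> continuous_on (\<Union>\<T>) u"
  by (simp add: fe_space_def)

text \<open>On each simplex there is an affine function with the prescribed values at the vertices.  Two
  such pieces agree on the common face of their simplices, being affine and equal at its vertices,
  so they glue to a continuous function.\<close>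

lemma nodal_values_exist:
  fixes f :: "real^'d \<Rightarrow> 'b::euclidean_space"
  shows "\<exists>u\<in>fe_space \<T>. \<forall>p\<in>nodes \<T>. u p = f p"
proof -
  have "\<forall>T\<in>\<T>. \<exists>L b. linear L \<and> (\<forall>p\<in>nodes \<T> \<inter> T. L p + b = f p)"
    using affine_interpolation_exists independent_nodes by blast
  then obtain L b where L: "\<And>T. T \<in> \<T> \<Longrightarrow> linear (L T)"
    "\<And>T p. \<lbrakk>T \<in> \<T>; p \<in> nodes \<T>; p \<in> T\<rbrakk> \<Longrightarrow> L T p + b T = f p"
    by (metis IntI)
  have agree: "L T x + b T = L T' x + b T'" if "T \<in> \<T>" "T' \<in> \<T>" "x \<in> T" "x \<in> T'" for T T' x
  proof -
    have "T \<inter> T' face_of convex hull (nodes \<T> \<inter> T)"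
      using face_mesh that hull_nodes by metis
    then obtain V where V: "V \<subseteq> nodes \<T> \<inter> T" "T \<inter> T' = convex hull V"
      using face_of_convex_hull_affine_independent[OF independent_nodes[OF \<open>T \<in> \<T>\<close>]] by blast
    then have "V \<subseteq> nodes \<T> \<inter> T \<inter> T'" using hull_subset[of V convex] by blast
    then have "L T p + b T = L T' p + b T'" if "p \<in> V" for p
      using L(2)[of _ p] \<open>p \<in> V\<close> \<open>T \<in> \<T>\<close> \<open>T' \<in> \<T>\<close> by (metis IntE subsetD)
    moreover have "x \<in> convex hull V" using V(2) that(3,4) by blast
    ultimately show ?thesis
      using affine_eq_on_hull[OF L(1)[OF that(1)] L(1)[OF that(2)], of V "b T" "b T'" x] by blast
  qed
  have "closed T" if "T \<in> \<T>" for T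
    using that by (intro compact_imp_closed compact_element)
  then have clo: "closedin (top_of_set (\<Union>\<T>)) T" if "T \<in> \<T>" for T
    using that by (intro closed_subset) auto
  have cont: "continuous_map (subtopology (top_of_set (\<Union>\<T>)) T) euclidean (\<lambda>x. L T x + b T)"
    if "T \<in> \<T>" for T
    unfolding subtopology_subtopology continuous_map_iff_continuous
    using linear_continuous_on[of "L T"] L(1)[OF that]
    by (intro continuous_intros) (simp add: linear_conv_bounded_linear)
  obtain u where u: "continuous_map (top_of_set (\<Union>\<T>)) euclidean u"
    "\<And>x T. \<lbrakk>T \<in> \<T>; x \<in> topspace (top_of_set (\<Union>\<T>)) \<inter> T\<rbrakk> \<Longrightarrow> u x = L T x + b T"
  proof (rule pasting_lemma_exists_closed[of \<T> "top_of_set (\<Union>\<T>)" "\<lambda>T. T" euclidean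
        "\<lambda>T x. L T x + b T", OF finite_mesh])
    show "L T x + b T = L T' x + b T'"
      if "T \<in> \<T>" "T' \<in> \<T>" "x \<in> topspace (top_of_set (\<Union>\<T>)) \<inter> T \<inter> T'" for T T' x
      using that by (intro agree) auto
  qed (use clo cont in \<open>auto simp: topspace_euclidean_subtopology\<close>)
  have u': "u x = L T x + b T" if "T \<in> \<T>" "x \<in> T" for x T
    using that u(2)[of T x] by auto
  have "u \<in> fe_space \<T>"
    using u(1) L(1) u' by (auto simp: fe_space_def)
  moreover have "u p = f p" if "p \<in> nodes \<T>" for p
  proof -
    obtain T where "T \<in> \<T>" "p \<in> T" by (rule node_element[OF \<open>p \<in> nodes \<T>\<close>])
    then show ?thesis using that u' L(2) by simp
  qed
  ultimately show ?thesis by blast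
qed

lemma
  shows hat_in_fe_space: "hat \<T> p \<in> fe_space \<T>"
    and hat_node: "q \<in> nodes \<T> \<Longrightarrow> hat \<T> p q = (if q = p then 1 else 0)"
proof -
  have "\<exists>\<phi>. \<phi> \<in> fe_space \<T> \<and> (\<forall>q\<in>nodes \<T>. \<phi> q = (if q = p then 1 else (0::real)))"
    using nodal_values_exist[of "\<lambda>q. if q = p then 1 else (0::real)"] by blast
  from someI_ex[OF this]
  show "hat \<T> p \<in> fe_space \<T>" "q \<in> nodes \<T> \<Longrightarrow> hat \<T> p q = (if q = p then 1 else 0)"
    by (auto simp: hat_def)
qed

lemma interp_node: "q \<in> nodes \<T> \<Longrightarrow> interp \<T> f q = f q"
  by (simp add: interp_def hat_node if_distrib[of "\<lambda>a. a *\<^sub>R _"] finite_nodes cong: if_cong)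

lemma fe_space_derivative:
  fixes u :: "real^'d \<Rightarrow> 'b::euclidean_space"
  assumes "linear L" "\<And>x. x \<in> T \<Longrightarrow> u x = L x + b" "x \<in> interior T"
  shows "frechet_derivative u (at x) = L"
proof -
  have "((\<lambda>x. L x + b) has_derivative L) (at x)"
    using assms(1) linear_imp_has_derivative[of L] by (auto intro!: derivative_eq_intros)
  moreover have "L y + b = u y" if "y \<in> interior T" for y
    using assms(2)[of y] that interior_subset[of T] by auto
  ultimately have "(u has_derivative L) (at x)"
    using assms(3) has_derivative_transform_within_open[of "\<lambda>x. L x + b" L x UNIV "interior T" u]
    by blast
  then show ?thesis by (rule frechet_derivative_at[symmetric])
qed

lemma interior_element_subset: "T \<in> \<T> \<Longrightarrow> interior T \<subseteq> \<Omega>"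
  using interior_mono[of T "closure \<Omega>"] open_domain(3) Union_mesh by auto

lemma interiors_disjoint: "disjoint_family_on interior \<T>"
proof (clarsimp simp: disjoint_family_on_def)
  fix T T' assume T: "T \<in> \<T>" "T' \<in> \<T>" "T \<noteq> T'"
  have "(T \<inter> T') \<inter> interior T = {}" if "T \<inter> T' \<noteq> T"
    using face_of_disjoint_interior[OF face_mesh that] T by blast
  moreover have "(T' \<inter> T) \<inter> interior T' = {}" if "T' \<inter> T \<noteq> T'"
    using face_of_disjoint_interior[OF face_mesh that] T by blast
  ultimately show "interior T \<inter> interior T' = {}"
    using interior_subset[of T] interior_subset[of T'] T(3) by blast
qed

text \<open>Up to the boundaries of the simplices, which are null sets since simplices are convex, the
  domain is the disjoint union of the open simplices.  Derivatives of finite element functions are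
  only determined there.\<close>

lemma
  fixes f :: "real^'d \<Rightarrow> 'b::euclidean_space"
  assumes "\<And>T. T \<in> \<T> \<Longrightarrow> set_integrable lebesgue (interior T) f"
  shows set_integrable_domain: "set_integrable lebesgue \<Omega> f"
    and integral_domain: "(LINT x:\<Omega>|lebesgue. f x) = (\<Sum>T\<in>\<T>. LINT x:interior T|lebesgue. f x)"
proof -
  let ?U = "\<Union>T\<in>\<T>. interior T"
  have "\<Omega> - ?U \<subseteq> (\<Union>T\<in>\<T>. frontier T)"
  proof
    fix x assume x: "x \<in> \<Omega> - ?U"
    then obtain T where "T \<in> \<T>" "x \<in> T" using closure_subset[of \<Omega>] Union_mesh by blast
    then show "x \<in> (\<Union>T\<in>\<T>. frontier T)"
      using x closure_subset[of T] by (auto simp: frontier_def)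
  qed
  moreover have "negligible (\<Union>T\<in>\<T>. frontier T)"
    using finite_mesh by (intro negligible_Union finite_imageI)
      (auto intro: negligible_convex_frontier convex_element)
  ultimately have N: "negligible (\<Omega> - ?U)" by (rule negligible_subset[rotated])
  have U: "?U \<subseteq> \<Omega>" using interior_element_subset by blast
  have fU: "set_integrable lebesgue ?U f"
    using assms finite_mesh by (intro set_integrable_UN) auto
  show f: "set_integrable lebesgue \<Omega> f"
    by (rule absolutely_integrable_spike_set[OF fU])
      (use U N in \<open>auto intro: negligible_subset\<close>)
  have "AE x in lebesgue. x \<notin> \<Omega> - ?U"
    by (rule AE_not_in) (use N in \<open>simp add: negligible_iff_null_sets\<close>)
  then have "(LINT x:\<Omega>|lebesgue. f x) = (LINT x:?U|lebesgue. f x)"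
    using f fU U
    by (intro set_integral_cong_set)
      (auto simp: set_integrable_def set_borel_measurable_def elim!: AE_mp)
  also have "\<dots> = (\<Sum>T\<in>\<T>. LINT x:interior T|lebesgue. f x)"
    using assms by (intro set_integral_finite_Union finite_mesh interiors_disjoint) auto
  finally show "(LINT x:\<Omega>|lebesgue. f x) = (\<Sum>T\<in>\<T>. LINT x:interior T|lebesgue. f x)" .
qed

lemma set_integrable_continuous_interior:
  fixes f :: "real^'d \<Rightarrow> 'b::euclidean_space"
  assumes "continuous_on (\<Union>\<T>) f" "T \<in> \<T>"
  shows "set_integrable lebesgue (interior T) f"
  using set_integrable_subset[OF set_integrable_continuous_compact[OF compact_element[OF assms(2)]
      continuous_on_subset[OF assms(1)]], of "interior T"] interior_subset[of T] assms(2)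
  by auto

lemma set_integrable_continuous:
  fixes f :: "real^'d \<Rightarrow> 'b::euclidean_space"
  assumes "continuous_on (\<Union>\<T>) f"
  shows "set_integrable lebesgue \<Omega> f"
  by (intro set_integrable_domain set_integrable_continuous_interior assms)

end

section \<open>Inverse estimates\<close>

lemma linear_eq_inner_axis:
  fixes L :: "real^'d::finite \<Rightarrow> real"
  assumes "linear L"
  shows "L x = (\<chi> i. L (axis i 1)) \<bullet> x"
proof -
  have "L x = L (\<Sum>i\<in>UNIV. x $ i *\<^sub>R axis i 1)"
    using basis_expansion[of x] by (simp add: scalar_mult_eq_scaleR)
  also have "\<dots> = (\<Sum>i\<in>UNIV. x $ i * L (axis i 1))"
    by (simp add: linear_sum[OF assms] linear_scale[OF assms])
  finally show ?thesis by (simp add: inner_vec_def mult.commute)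
qed

context simplicial_mesh
begin

lemma grad_hat:
  assumes "T \<in> \<T>" "p \<in> nodes \<T>"
  shows "\<exists>G. (\<forall>x\<in>interior T. grad (hat \<T> p) x = G) \<and> inradius T * norm G \<le> 1 \<and> (p \<notin> T \<longrightarrow> G = 0)"
proof -
  obtain L b where L: "linear L" "\<And>x. x \<in> T \<Longrightarrow> hat \<T> p x = L x + b"
    using fe_space_affine[OF hat_in_fe_space[of p] assms(1)] by blast
  have node: "L q + b = (if q = p then 1 else 0)" if "q \<in> nodes \<T> \<inter> T" for q
    using that L(2)[of q] hat_node[of q p] by simp
  show ?thesis
  proof (cases "p \<in> T")
    case True
    define G where "G = (\<chi> i. L (axis i 1))"
    have "0 \<le> G \<bullet> x + b \<and> G \<bullet> x + b \<le> 1" if "x \<in> T" for x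
      using affine_in_convex_on_hull[OF L(1), of "{0..1}" "nodes \<T> \<inter> T" b x] node that
        hull_nodes[OF assms(1)] linear_eq_inner_axis[OF L(1), of x] by (auto simp: G_def)
    then have "inradius T * norm G \<le> 1" by (rule inradius_gradient_le_1)
    moreover have "grad (hat \<T> p) x = G" if "x \<in> interior T" for x
      using fe_space_derivative[of L T "hat \<T> p" b x] L that
      by (simp add: grad_def partial_def G_def)
    ultimately show ?thesis using True by blast
  next
    case False
    then have "L q + b \<in> {0}" if "q \<in> nodes \<T> \<inter> T" for q
      using node[OF that] that by auto
    then have "hat \<T> p x = 0" if "x \<in> T" for x
      using affine_in_convex_on_hull[OF L(1) convex_singleton, of "nodes \<T> \<inter> T" b 0 x] that
        hull_nodes[OF assms(1)] L(2)[OF that] by simp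
    then have "grad (hat \<T> p) x = 0" if "x \<in> interior T" for x
      using fe_space_derivative[of "\<lambda>_. 0" T "hat \<T> p" 0 x] that
      by (simp add: grad_def partial_def vec_eq_iff linear_zero)
    then show ?thesis by auto
  qed
qed

text \<open>Only simplices that contain both nodes contribute to the entry, and there both hat functions
  have slope at most \<open>1 / inradius T\<close>.\<close>

lemma abs_stiffness_le:
  assumes "p \<in> nodes \<T>" "q \<in> nodes \<T>"
  shows "\<bar>stiffness \<Omega> \<T> p q\<bar>
    \<le> (\<Sum>T\<in>{T\<in>\<T>. p \<in> T \<and> q \<in> T}. measure lebesgue T / (inradius T)\<^sup>2)"
proof -
  define G where "G T r = (SOME G. (\<forall>x\<in>interior T. grad (hat \<T> r) x = G) \<and>
    inradius T * norm G \<le> 1 \<and> (r \<notin> T \<longrightarrow> G = 0))" for T r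
  have G_all: "(\<forall>x\<in>interior T. grad (hat \<T> r) x = G T r) \<and>
    inradius T * norm (G T r) \<le> 1 \<and> (r \<notin> T \<longrightarrow> G T r = 0)" if "T \<in> \<T>" "r \<in> nodes \<T>" for T r
    using someI_ex[OF grad_hat[OF that]] unfolding G_def .
  have G: "\<lbrakk>T \<in> \<T>; r \<in> nodes \<T>; x \<in> interior T\<rbrakk> \<Longrightarrow> grad (hat \<T> r) x = G T r"
    "\<lbrakk>T \<in> \<T>; r \<in> nodes \<T>\<rbrakk> \<Longrightarrow> inradius T * norm (G T r) \<le> 1"
    "\<lbrakk>T \<in> \<T>; r \<in> nodes \<T>; r \<notin> T\<rbrakk> \<Longrightarrow> G T r = 0" for T r x
    using G_all by blast+
  let ?f = "\<lambda>x. grad (hat \<T> p) x \<bullet> grad (hat \<T> q) x"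
  have fin: "interior T \<in> sets lebesgue" "emeasure lebesgue (interior T) \<noteq> \<infinity>"
    "measure lebesgue (interior T) \<le> measure lebesgue T" if "T \<in> \<T>" for T
  proof -
    have T: "T \<in> lmeasurable" and iT: "interior T \<in> lmeasurable"
      using compact_element[OF that] by (auto intro: lmeasurable_compact lmeasurable_interior compact_imp_bounded)
    show "interior T \<in> sets lebesgue" "emeasure lebesgue (interior T) \<noteq> \<infinity>"
      using fmeasurableD[OF iT] fmeasurableD2[OF iT] by simp_all
    show "measure lebesgue (interior T) \<le> measure lebesgue T"
      by (rule measure_mono_fmeasurable[OF interior_subset fmeasurableD[OF iT] T])
  qed
  have eq: "set_integrable lebesgue (interior T) ?f"
    "(LINT x:interior T|lebesgue. ?f x) = measure lebesgue (interior T) * (G T p \<bullet> G T q)"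
    if "T \<in> \<T>" for T
  proof -
    have int: "set_integrable lebesgue (interior T) (\<lambda>_. G T p \<bullet> G T q)"
      by (intro set_integrable_continuous_interior continuous_on_const that)
    show "set_integrable lebesgue (interior T) ?f"
      by (rule set_integrable_cong[THEN iffD1, OF refl refl _ int]) (simp add: G(1)[OF that] assms)
    have "(LINT x:interior T|lebesgue. ?f x) = (LINT x:interior T|lebesgue. G T p \<bullet> G T q)"
      using G(1)[OF that] assms fin[OF that] by (intro set_lebesgue_integral_cong) auto
    then show "(LINT x:interior T|lebesgue. ?f x) = measure lebesgue (interior T) * (G T p \<bullet> G T q)"
      using fin[OF that] by (simp add: set_integral_const)
  qed
  have "stiffness \<Omega> \<T> p q = - (\<Sum>T\<in>\<T>. measure lebesgue (interior T) * (G T p \<bullet> G T q))"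
    unfolding stiffness_def by (simp add: integral_domain[OF eq(1)] eq(2))
  also have "\<bar>\<dots>\<bar> \<le> (\<Sum>T\<in>\<T>. \<bar>measure lebesgue (interior T) * (G T p \<bullet> G T q)\<bar>)"
    by (simp add: sum_abs)
  also have "\<dots> = (\<Sum>T\<in>{T\<in>\<T>. p \<in> T \<and> q \<in> T}. \<bar>measure lebesgue (interior T) * (G T p \<bullet> G T q)\<bar>)"
  proof (rule sum.mono_neutral_right[OF finite_mesh])
    show "\<forall>T\<in>\<T> - {T\<in>\<T>. p \<in> T \<and> q \<in> T}. \<bar>measure lebesgue (interior T) * (G T p \<bullet> G T q)\<bar> = 0"
    proof
      fix T assume "T \<in> \<T> - {T\<in>\<T>. p \<in> T \<and> q \<in> T}"
      then have "G T p = 0 \<or> G T q = 0" using G(3) assms by blast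
      then show "\<bar>measure lebesgue (interior T) * (G T p \<bullet> G T q)\<bar> = 0" by auto
    qed
  qed auto
  also have "\<dots> \<le> (\<Sum>T\<in>{T\<in>\<T>. p \<in> T \<and> q \<in> T}. measure lebesgue T / (inradius T)\<^sup>2)"
  proof (rule sum_mono)
    fix T assume "T \<in> {T\<in>\<T>. p \<in> T \<and> q \<in> T}"
    then have T: "T \<in> \<T>" by blast
    have \<rho>: "inradius T > 0" by (rule inradius_element_pos[OF T])
    have "norm (G T r) \<le> 1 / inradius T" if "r \<in> nodes \<T>" for r
      using G(2)[OF T that] \<rho> by (simp add: field_simps)
    then have "norm (G T p) * norm (G T q) \<le> (1 / inradius T) * (1 / inradius T)"
      using assms \<rho> by (intro mult_mono) auto
    then have "\<bar>G T p \<bullet> G T q\<bar> \<le> 1 / (inradius T)\<^sup>2"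
      using Cauchy_Schwarz_ineq2[of "G T p" "G T q"] by (simp add: power2_eq_square)
    then show "\<bar>measure lebesgue (interior T) * (G T p \<bullet> G T q)\<bar> \<le> measure lebesgue T / (inradius T)\<^sup>2"
      using mult_mono[OF fin(3)[OF T], of "\<bar>G T p \<bullet> G T q\<bar>" "1 / (inradius T)\<^sup>2"]
      by (simp add: abs_mult)
  qed
  finally show ?thesis .
qed

lemma jacobian_element:
  fixes u :: "real^'d \<Rightarrow> real^'m::finite"
  assumes "u \<in> fe_space \<T>" "T \<in> \<T>"
  obtains J where "\<And>x. x \<in> interior T \<Longrightarrow> jacobian u (at x) = J"
    "\<And>x y. \<lbrakk>x \<in> T; y \<in> T\<rbrakk> \<Longrightarrow> u x - u y = J *v (x - y)"
proof -
  obtain L b where L: "linear L" "\<And>x. x \<in> T \<Longrightarrow> u x = L x + b"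
    using fe_space_affine[OF assms] by blast
  show thesis
  proof (rule that[of "matrix L"])
    show "jacobian u (at x) = matrix L" if "x \<in> interior T" for x
      using fe_space_derivative[of L T u b x] L that by (simp add: jacobian_def)
    show "u x - u y = matrix L *v (x - y)" if "x \<in> T" "y \<in> T" for x y
      using L(2) that linear_diff[OF L(1)] fun_cong[OF matrix_vector_mul(2)[OF L(1)]] by simp
  qed
qed

lemma fe_norm_sq_le_mean_square:
  fixes u :: "real^'d \<Rightarrow> 'b::euclidean_space"
  assumes "u \<in> fe_space \<T>" "T \<in> \<T>" "x \<in> T"
  shows "(norm (u x))\<^sup>2 * measure lebesgue T
    \<le> 4 ^ (CARD('d) + 1) * (LINT y:interior T|lebesgue. (norm (u y))\<^sup>2)"
proof -
  obtain L b where L: "linear L" "\<And>x. x \<in> T \<Longrightarrow> u x = L x + b"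
    using fe_space_affine[OF assms(1,2)] by blast
  from affine_norm_sq_le_mean_square[OF compact_element[OF assms(2)] convex_element[OF assms(2)] L assms(3)]
  show ?thesis by simp
qed

lemma
  fixes t :: "real^'d \<Rightarrow> real^'m::finite"
  assumes "t \<in> fe_space \<T>" "continuous_on (\<Union>\<T>) w"
  shows set_integrable_jacobian_element:
    "T \<in> \<T> \<Longrightarrow> set_integrable lebesgue (interior T) (\<lambda>x. (norm (jacobian t (at x)))\<^sup>2 * w x)"
  and set_integrable_jacobian:
    "set_integrable lebesgue \<Omega> (\<lambda>x. (norm (jacobian t (at x)))\<^sup>2 * w x)"
proof -
  show *: "set_integrable lebesgue (interior T) (\<lambda>x. (norm (jacobian t (at x)))\<^sup>2 * w x)"
    if "T \<in> \<T>" for T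
  proof -
    obtain J where J: "\<And>x. x \<in> interior T \<Longrightarrow> jacobian t (at x) = J"
      "\<And>x y. \<lbrakk>x \<in> T; y \<in> T\<rbrakk> \<Longrightarrow> t x - t y = J *v (x - y)"
      using jacobian_element[OF assms(1) \<open>T \<in> \<T>\<close>] by blast
    have int: "set_integrable lebesgue (interior T) (\<lambda>x. (norm J)\<^sup>2 * w x)"
      using set_integrable_continuous_interior[OF continuous_on_mult_left[OF assms(2)] that] .
    show ?thesis
      by (rule set_integrable_cong[THEN iffD1, OF refl refl _ int]) (simp add: J(1))
  qed
  then show "set_integrable lebesgue \<Omega> (\<lambda>x. (norm (jacobian t (at x)))\<^sup>2 * w x)"
    by (rule set_integrable_domain)
qed

text \<open>The quotient of diameter and inradius is at most \<open>\<sigma>\<close>, so \<open>norm (t p - t q) / inradius T\<close> is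
  at most \<open>\<sigma>\<close> times the norm of the Jacobian, which is constant on the simplex.  The nodal values of
  \<open>s\<^sup>2\<close> are controlled by its mean over the simplex.\<close>

lemma element_difference_le:
  fixes t :: "real^'d \<Rightarrow> real^'m::finite" and s :: "real^'d \<Rightarrow> real"
  assumes t: "t \<in> fe_space \<T>" and s: "s \<in> fe_space \<T>" and T: "T \<in> \<T>" and \<sigma>: "shape_regular \<sigma> \<T>"
    and p: "p \<in> T" "q \<in> T"
  shows "measure lebesgue T / (inradius T)\<^sup>2 * (((s p)\<^sup>2 + (s q)\<^sup>2) / 2) * (norm (t p - t q))\<^sup>2
    \<le> \<sigma>\<^sup>2 * 4 ^ (CARD('d) + 1) * (LINT x:interior T|lebesgue. (norm (jacobian t (at x)))\<^sup>2 * (s x)\<^sup>2)"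
proof -
  obtain J where J: "\<And>x. x \<in> interior T \<Longrightarrow> jacobian t (at x) = J"
    "\<And>x y. \<lbrakk>x \<in> T; y \<in> T\<rbrakk> \<Longrightarrow> t x - t y = J *v (x - y)"
    using jacobian_element[OF t T] by blast
  define I where "I = (LINT x:interior T|lebesgue. (s x)\<^sup>2)"
  have I0: "I \<ge> 0"
    unfolding I_def set_lebesgue_integral_def by (intro Bochner_Integration.integral_nonneg) simp
  have \<rho>: "inradius T > 0" by (rule inradius_element_pos[OF T])
  have "norm (t p - t q) \<le> norm J * norm (p - q)"
    using J(2)[OF p] norm_matrix_vector_le[of J "p - q"] by simp
  also have "norm (p - q) \<le> diameter T"
    using diameter_bounded_bound[OF compact_imp_bounded[OF compact_element[OF T]] p] by (simp add: dist_norm)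
  also have "diameter T \<le> \<sigma> * inradius T"
    using \<sigma> T by (simp add: shape_regular_def)
  finally have "norm (t p - t q) \<le> norm J * (\<sigma> * inradius T)" by (simp add: mult_left_mono)
  then have "(norm (t p - t q))\<^sup>2 \<le> (norm J * (\<sigma> * inradius T))\<^sup>2"
    by (intro power_mono) auto
  then have dt: "(norm (t p - t q))\<^sup>2 / (inradius T)\<^sup>2 \<le> (norm J)\<^sup>2 * \<sigma>\<^sup>2"
    using \<rho> by (simp add: field_simps)
  have "(s x)\<^sup>2 * measure lebesgue T \<le> 4 ^ (CARD('d) + 1) * I" if "x \<in> T" for x
    using fe_norm_sq_le_mean_square[OF s T that] by (simp add: I_def)
  from this[OF p(1)] this[OF p(2)]
  have ds: "((s p)\<^sup>2 + (s q)\<^sup>2) / 2 * measure lebesgue T \<le> 4 ^ (CARD('d) + 1) * I"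
    by (simp add: field_simps)
  have "measure lebesgue T / (inradius T)\<^sup>2 * (((s p)\<^sup>2 + (s q)\<^sup>2) / 2) * (norm (t p - t q))\<^sup>2
    = (((s p)\<^sup>2 + (s q)\<^sup>2) / 2 * measure lebesgue T) * ((norm (t p - t q))\<^sup>2 / (inradius T)\<^sup>2)"
    by (simp add: mult.commute)
  also have "\<dots> \<le> (4 ^ (CARD('d) + 1) * I) * ((norm J)\<^sup>2 * \<sigma>\<^sup>2)"
    using ds dt I0 by (intro mult_mono[OF ds dt] mult_nonneg_nonneg) auto
  also have "\<dots> = \<sigma>\<^sup>2 * 4 ^ (CARD('d) + 1) * (LINT x:interior T|lebesgue. (norm J)\<^sup>2 * (s x)\<^sup>2)"
    by (simp add: I_def algebra_simps)
  also have "(LINT x:interior T|lebesgue. (norm J)\<^sup>2 * (s x)\<^sup>2)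
    = (LINT x:interior T|lebesgue. (norm (jacobian t (at x)))\<^sup>2 * (s x)\<^sup>2)"
    using J(1) by (intro set_lebesgue_integral_cong) auto
  finally show ?thesis .
qed

text \<open>Distribute the stiffness entries over the simplices and count the pairs of vertices of each
  simplex.  Individual contributions of simplices to an entry may have either sign, and therefore the
  estimate is made simplex by simplex for absolute values.  The degenerate weight \<open>s\<^sup>2\<close> survives on
  the right-hand side: this is what matches the weighted norm of the algorithm.\<close>

lemma stiffness_weighted_difference_le:
  fixes t :: "real^'d \<Rightarrow> real^'m::finite" and s :: "real^'d \<Rightarrow> real"
  assumes t: "t \<in> fe_space \<T>" and s: "s \<in> fe_space \<T>" and \<sigma>: "shape_regular \<sigma> \<T>"
  shows "(\<Sum>p\<in>nodes \<T>. \<Sum>q\<in>nodes \<T>.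
      \<bar>stiffness \<Omega> \<T> p q\<bar> * (((s p)\<^sup>2 + (s q)\<^sup>2) / 2) * (norm (t p - t q))\<^sup>2)
    \<le> (real (CARD('d) + 1))\<^sup>2 * (\<sigma>\<^sup>2 * 4 ^ (CARD('d) + 1)) *
      (LINT x:\<Omega>|lebesgue. (norm (jacobian t (at x)))\<^sup>2 * (s x)\<^sup>2)"
proof -
  let ?N = "nodes \<T>"
  let ?w = "\<lambda>p q. ((s p)\<^sup>2 + (s q)\<^sup>2) / 2 * (norm (t p - t q))\<^sup>2"
  let ?m = "\<lambda>T. measure lebesgue T / (inradius T)\<^sup>2"
  let ?D = "\<lambda>T. \<sigma>\<^sup>2 * 4 ^ (CARD('d) + 1) * (LINT x:interior T|lebesgue. (norm (jacobian t (at x)))\<^sup>2 * (s x)\<^sup>2)"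
  have "(\<Sum>p\<in>?N. \<Sum>q\<in>?N. \<bar>stiffness \<Omega> \<T> p q\<bar> * (((s p)\<^sup>2 + (s q)\<^sup>2) / 2) * (norm (t p - t q))\<^sup>2)
      \<le> (\<Sum>p\<in>?N. \<Sum>q\<in>?N. (\<Sum>T\<in>\<T>. if p \<in> T \<and> q \<in> T then ?m T else 0) * ?w p q)"
    using abs_stiffness_le finite_mesh
    by (intro sum_mono) (simp add: mult_right_mono sum.If_cases mult.assoc Int_def)
  also have "\<dots> = (\<Sum>p\<in>?N. \<Sum>q\<in>?N. \<Sum>T\<in>\<T>. if p \<in> T \<and> q \<in> T then ?m T * ?w p q else 0)"
    unfolding sum_distrib_right by (intro sum.cong refl) simp
  also have "\<dots> = (\<Sum>p\<in>?N. \<Sum>T\<in>\<T>. \<Sum>q\<in>?N. if p \<in> T \<and> q \<in> T then ?m T * ?w p q else 0)"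
    by (intro sum.cong refl sum.swap)
  also have "\<dots> = (\<Sum>T\<in>\<T>. \<Sum>p\<in>?N. \<Sum>q\<in>?N. if p \<in> T \<and> q \<in> T then ?m T * ?w p q else 0)"
    by (rule sum.swap)
  also have "\<dots> = (\<Sum>T\<in>\<T>. \<Sum>p\<in>?N \<inter> T. \<Sum>q\<in>?N \<inter> T. ?m T * ?w p q)"
    by (simp only: sum.inter_restrict[OF finite_nodes], intro sum.cong refl) auto
  also have "\<dots> \<le> (\<Sum>T\<in>\<T>. \<Sum>p\<in>?N \<inter> T. \<Sum>q\<in>?N \<inter> T. ?D T)"
    using element_difference_le[OF t s _ \<sigma>] by (intro sum_mono) (simp add: mult.assoc)
  also have "\<dots> = (\<Sum>T\<in>\<T>. (real (CARD('d) + 1))\<^sup>2 * ?D T)"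
    by (intro sum.cong refl) (simp only: sum_constant card_nodes power2_eq_square mult.assoc)
  also have "\<dots> = (real (CARD('d) + 1))\<^sup>2 * (\<sigma>\<^sup>2 * 4 ^ (CARD('d) + 1)) *
      (\<Sum>T\<in>\<T>. LINT x:interior T|lebesgue. (norm (jacobian t (at x)))\<^sup>2 * (s x)\<^sup>2)"
    by (simp only: sum_distrib_left mult.assoc)
  also have "(\<Sum>T\<in>\<T>. LINT x:interior T|lebesgue. (norm (jacobian t (at x)))\<^sup>2 * (s x)\<^sup>2)
    = (LINT x:\<Omega>|lebesgue. (norm (jacobian t (at x)))\<^sup>2 * (s x)\<^sup>2)"
    using fe_space_continuous[OF s] t
    by (intro integral_domain[symmetric] set_integrable_jacobian_element continuous_intros) auto
  finally show ?thesis .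
qed

lemma mesh_size_pos: "0 < mesh_size \<T>"
proof -
  obtain T where T: "T \<in> \<T>" using mesh_nonempty by blast
  then have "diameter T \<le> mesh_size \<T>"
    unfolding mesh_size_def using finite_mesh by (intro Max_ge) auto
  then show ?thesis using diameter_element_pos[OF T] by simp
qed

lemma shape_regular_pos:
  assumes "shape_regular \<sigma> \<T>" shows "\<sigma> > 0"
proof -
  obtain T where T: "T \<in> \<T>" using mesh_nonempty by blast
  then have "0 < \<sigma> * inradius T"
    using assms diameter_element_pos[OF T] by (force simp: shape_regular_def)
  then show ?thesis using inradius_element_pos[OF T] by (simp add: zero_less_mult_iff)
qed

lemma quasi_uniform_pos:
  assumes "quasi_uniform \<kappa> \<T>" shows "\<kappa> > 0"
proof -
  obtain T where T: "T \<in> \<T>" using mesh_nonempty by blast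
  then have "0 < \<kappa> * diameter T"
    using assms mesh_size_pos by (force simp: quasi_uniform_def)
  then show ?thesis using diameter_element_pos[OF T] by (simp add: zero_less_mult_iff)
qed

text \<open>The simplex around the node has measure at least a constant times \<open>mesh_size \<T> ^ CARD('d)\<close>:
  quasi-uniformity bounds its diameter from below, and shape regularity its inradius.\<close>

lemma nodal_value_le_L2:
  fixes u :: "real^'d \<Rightarrow> 'b::euclidean_space"
  assumes u: "u \<in> fe_space \<T>" and \<sigma>: "shape_regular \<sigma> \<T>" and \<kappa>: "quasi_uniform \<kappa> \<T>" and p: "p \<in> nodes \<T>"
  shows "(norm (u p))\<^sup>2 * ((mesh_size \<T> / (2 * \<sigma> * \<kappa>)) ^ CARD('d) * measure lebesgue (ball (0::real^'d) 1))
    \<le> 4 ^ (CARD('d) + 1) * (LINT x:\<Omega>|lebesgue. (norm (u x))\<^sup>2)"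
proof -
  obtain T where T: "T \<in> \<T>" "p \<in> T" by (rule node_element[OF p])
  have pos: "\<sigma> > 0" "\<kappa> > 0" "mesh_size \<T> > 0" "inradius T > 0"
    using shape_regular_pos[OF \<sigma>] quasi_uniform_pos[OF \<kappa>] mesh_size_pos inradius_element_pos T by auto
  have "mesh_size \<T> \<le> \<kappa> * diameter T" "diameter T \<le> \<sigma> * inradius T"
    using \<kappa> \<sigma> T by (auto simp: quasi_uniform_def shape_regular_def)
  then have "mesh_size \<T> \<le> \<kappa> * (\<sigma> * inradius T)"
    using pos by (meson mult_left_mono order_trans less_imp_le)
  then have "mesh_size \<T> / (2 * \<sigma> * \<kappa>) \<le> inradius T / 2"
    using pos by (simp add: field_simps)
  then have "(mesh_size \<T> / (2 * \<sigma> * \<kappa>)) ^ CARD('d) * measure lebesgue (ball (0::real^'d) 1)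
    \<le> (inradius T / 2) ^ CARD('d) * measure lebesgue (ball (0::real^'d) 1)"
    using pos by (intro mult_right_mono power_mono) auto
  also have "\<dots> \<le> measure lebesgue T"
    by (intro measure_ge_inradius_power compact_element T pos)
  finally have "(norm (u p))\<^sup>2 * ((mesh_size \<T> / (2 * \<sigma> * \<kappa>)) ^ CARD('d) * measure lebesgue (ball (0::real^'d) 1))
    \<le> (norm (u p))\<^sup>2 * measure lebesgue T"
    by (rule mult_left_mono) simp
  also have "\<dots> \<le> 4 ^ (CARD('d) + 1) * (LINT x:interior T|lebesgue. (norm (u x))\<^sup>2)"
    by (rule fe_norm_sq_le_mean_square[OF u T])
  also have "\<dots> \<le> 4 ^ (CARD('d) + 1) * (LINT x:\<Omega>|lebesgue. (norm (u x))\<^sup>2)"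
    using fe_space_continuous[OF u] interior_element_subset[OF T(1)]
    by (intro mult_left_mono set_integral_subset_le set_integrable_continuous continuous_intros) auto
  finally show ?thesis .
qed

end

section \<open>The energies as quadratic forms\<close>

lemma deriv_quadratic:
  fixes a b c :: real
  assumes "\<And>\<epsilon>. f \<epsilon> = a + \<epsilon> * b + \<epsilon>\<^sup>2 * c"
  shows "deriv f 0 = b"
proof -
  have "f = (\<lambda>\<epsilon>. a + \<epsilon> * b + \<epsilon>\<^sup>2 * c)" using assms by auto
  moreover have "((\<lambda>\<epsilon>. a + \<epsilon> * b + \<epsilon>\<^sup>2 * c) has_real_derivative b) (at 0)"
    by (auto intro!: derivative_eq_intros)
  ultimately show ?thesis by (simp add: DERIV_imp_deriv)
qed

text \<open>The polarisation of \<open>E_uni_i\<close>, which for fixed \<open>s\<close> is a quadratic form in the matrix field.\<close>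

definition E_uni_i_form :: "(real^'d::finite) set \<Rightarrow> (real^'d) set set \<Rightarrow> (real^'d \<Rightarrow> real)
    \<Rightarrow> (real^'d \<Rightarrow> real^'d^'d) \<Rightarrow> (real^'d \<Rightarrow> real^'d^'d) \<Rightarrow> real" where
  "E_uni_i_form \<Omega> \<T> s V W = 1/4 * (\<Sum>p\<in>nodes \<T>. \<Sum>q\<in>nodes \<T>.
     stiffness \<Omega> \<T> p q * (((s p)\<^sup>2 + (s q)\<^sup>2) / 2) * ((V p - V q) \<bullet> (W p - W q)))"

lemma E_uni_i_add_scaled:
  "E_uni_i \<Omega> \<T> s (\<lambda>x. V x + \<epsilon> *\<^sub>R W x)
    = E_uni_i \<Omega> \<T> s V + \<epsilon> * (2 * E_uni_i_form \<Omega> \<T> s V W) + \<epsilon>\<^sup>2 * E_uni_i \<Omega> \<T> s W"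
proof -
  have *: "(norm (V p + \<epsilon> *\<^sub>R W p - (V q + \<epsilon> *\<^sub>R W q)))\<^sup>2
    = (norm (V p - V q))\<^sup>2 + 2 * \<epsilon> * ((V p - V q) \<bullet> (W p - W q)) + \<epsilon>\<^sup>2 * (norm (W p - W q))\<^sup>2" for p q
  proof -
    have "V p + \<epsilon> *\<^sub>R W p - (V q + \<epsilon> *\<^sub>R W q) = (V p - V q) + \<epsilon> *\<^sub>R (W p - W q)"
      by (simp add: algebra_simps)
    then show ?thesis
      unfolding power2_norm_eq_inner
      by (simp only: inner_add_left inner_add_right inner_scaleR_left inner_scaleR_right
          inner_commute[of "W p - W q" "V p - V q"]) (simp add: power2_eq_square distrib_left mult.assoc)
  qed
  have "k * w * (x + 2 * \<epsilon> * y + \<epsilon>\<^sup>2 * z) = k * w * x + 2 * \<epsilon> * (k * w * y) + \<epsilon>\<^sup>2 * (k * w * z)"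
    for k w x y z :: real by (simp add: algebra_simps)
  then show ?thesis
    unfolding E_uni_i_def E_uni_i_form_def *
    by (simp only: sum.distrib sum_distrib_left[symmetric] distrib_left)
qed

lemma E_uni_i_add:
  "E_uni_i \<Omega> \<T> s (\<lambda>x. V x + W x)
    = E_uni_i \<Omega> \<T> s V + 2 * E_uni_i_form \<Omega> \<T> s V W + E_uni_i \<Omega> \<T> s W"
  using E_uni_i_add_scaled[of \<Omega> \<T> s V 1 W] by simp

lemma var_Theta_E_uni_i_eq: "var_Theta_E_uni_i \<Omega> \<T> s V W = 2 * E_uni_i_form \<Omega> \<T> s V W"
  unfolding var_Theta_E_uni_i_def by (rule deriv_quadratic) (rule E_uni_i_add_scaled)

lemma E_uni_m_add_scaled:
  "\<exists>b. \<forall>\<epsilon>. E_uni_m \<Omega> \<T> (\<lambda>x. s x + \<epsilon> * z x) \<Theta> = E_uni_m \<Omega> \<T> s \<Theta> + \<epsilon> * b + \<epsilon>\<^sup>2 * E_uni_m \<Omega> \<T> z \<Theta>"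
    for \<Omega> :: "(real^'d::finite) set"
proof -
  define \<alpha> where "\<alpha> = (real CARD('d) - 1) / (4 * real CARD('d))"
  define k where "k = stiffness \<Omega> \<T>"
  define w where "w p q = (norm (\<Theta> p - \<Theta> q))\<^sup>2" for p q
  have E: "E_uni_m \<Omega> \<T> u \<Theta> = (\<Sum>p\<in>nodes \<T>. \<Sum>q\<in>nodes \<T>.
      k p q * (\<alpha> * (u p - u q)\<^sup>2 + 1/8 * ((u p)\<^sup>2 + (u q)\<^sup>2) * w p q))" for u
  proof -
    have "E_uni_m \<Omega> \<T> u \<Theta> = \<alpha> * (\<Sum>p\<in>nodes \<T>. \<Sum>q\<in>nodes \<T>. k p q * (u p - u q)\<^sup>2)
      + 1/4 * (\<Sum>p\<in>nodes \<T>. \<Sum>q\<in>nodes \<T>. k p q * (((u p)\<^sup>2 + (u q)\<^sup>2) / 2) * w p q)"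
      by (simp add: E_uni_m_def E_uni_i_def \<alpha>_def k_def w_def)
    then show ?thesis
      unfolding sum_distrib_left sum.distrib[symmetric]
      by (simp add: algebra_simps add_divide_distrib)
  qed
  define b where "b = (\<Sum>p\<in>nodes \<T>. \<Sum>q\<in>nodes \<T>.
      k p q * (\<alpha> * (2 * (s p - s q) * (z p - z q)) + 1/8 * (2 * s p * z p + 2 * s q * z q) * w p q))"
  have "E_uni_m \<Omega> \<T> (\<lambda>x. s x + \<epsilon> * z x) \<Theta> = E_uni_m \<Omega> \<T> s \<Theta> + \<epsilon> * b + \<epsilon>\<^sup>2 * E_uni_m \<Omega> \<T> z \<Theta>" for \<epsilon>
    unfolding E b_def sum_distrib_left sum.distrib[symmetric]
    by (intro sum.cong refl) algebra
  then show ?thesis by blast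
qed

text \<open>For a homogeneous quadratic functional the derivative at the new point in the direction of the increment
  is the gain in energy plus the energy of the increment; this is the algebra behind the implicit
  treatment of \<open>s\<close>.\<close>

lemma var_s_E_uni_m_increment:
  "var_s_E_uni_m \<Omega> \<T> s' \<Theta> (\<lambda>x. s' x - s x)
    = E_uni_m \<Omega> \<T> s' \<Theta> - E_uni_m \<Omega> \<T> s \<Theta> + E_uni_m \<Omega> \<T> (\<lambda>x. s' x - s x) \<Theta>"
proof -
  \<comment> \<open>Evaluating the quadratic polynomial at \<open>\<epsilon> = -1\<close> recovers the energy of \<open>s\<close>.\<close>
  obtain b where b: "\<And>\<epsilon>. E_uni_m \<Omega> \<T> (\<lambda>x. s' x + \<epsilon> * (s' x - s x)) \<Theta>
    = E_uni_m \<Omega> \<T> s' \<Theta> + \<epsilon> * b + \<epsilon>\<^sup>2 * E_uni_m \<Omega> \<T> (\<lambda>x. s' x - s x) \<Theta>"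
    using E_uni_m_add_scaled[of \<Omega> \<T> s' "\<lambda>x. s' x - s x" \<Theta>] by blast
  have "var_s_E_uni_m \<Omega> \<T> s' \<Theta> (\<lambda>x. s' x - s x) = b"
    unfolding var_s_E_uni_m_def by (rule deriv_quadratic) (rule b)
  moreover have "E_uni_m \<Omega> \<T> s \<Theta> = E_uni_m \<Omega> \<T> s' \<Theta> - b + E_uni_m \<Omega> \<T> (\<lambda>x. s' x - s x) \<Theta>"
    using b[of "-1"] by simp
  ultimately show ?thesis by simp
qed

text \<open>The diagonal entries of \<open>stiffness\<close> are nonpositive, but they only occur multiplied by a
  difference of a field with itself.\<close>

lemma stiffness_term_nonneg:
  assumes "weakly_acute \<Omega> \<T>" "p \<in> nodes \<T>" "q \<in> nodes \<T>" "x \<ge> 0" "p = q \<Longrightarrow> x = 0"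
  shows "0 \<le> stiffness \<Omega> \<T> p q * x"
  using assms by (cases "p = q") (auto simp: weakly_acute_def)

lemma E_uni_i_mono:
  assumes "weakly_acute \<Omega> \<T>"
    and "\<And>p q. \<lbrakk>p \<in> nodes \<T>; q \<in> nodes \<T>\<rbrakk> \<Longrightarrow> norm (V p - V q) \<le> norm (W p - W q)"
  shows "E_uni_i \<Omega> \<T> s V \<le> E_uni_i \<Omega> \<T> s W"
  unfolding E_uni_i_def
proof (rule mult_left_mono[OF sum_mono[OF sum_mono]])
  fix p q assume pq: "p \<in> nodes \<T>" "q \<in> nodes \<T>"
  have "0 \<le> stiffness \<Omega> \<T> p q * (((s p)\<^sup>2 + (s q)\<^sup>2) / 2 * ((norm (W p - W q))\<^sup>2 - (norm (V p - V q))\<^sup>2))"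
    using assms(2)[OF pq] by (intro stiffness_term_nonneg assms pq) (auto intro!: mult_nonneg_nonneg power_mono)
  then show "stiffness \<Omega> \<T> p q * (((s p)\<^sup>2 + (s q)\<^sup>2) / 2) * (norm (V p - V q))\<^sup>2
    \<le> stiffness \<Omega> \<T> p q * (((s p)\<^sup>2 + (s q)\<^sup>2) / 2) * (norm (W p - W q))\<^sup>2"
    by (simp add: algebra_simps)
qed simp

lemma E_uni_i_nonneg:
  assumes "weakly_acute \<Omega> \<T>" shows "0 \<le> E_uni_i \<Omega> \<T> s V"
  using E_uni_i_mono[OF assms, of "\<lambda>_. 0" V s] by (simp add: E_uni_i_def)

lemma E_uni_i_le_E_uni_m:
  fixes \<Omega> :: "(real^'d::finite) set"
  assumes "weakly_acute \<Omega> \<T>" shows "E_uni_i \<Omega> \<T> s V \<le> E_uni_m \<Omega> \<T> s V"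
proof -
  have "0 \<le> (\<Sum>p\<in>nodes \<T>. \<Sum>q\<in>nodes \<T>. stiffness \<Omega> \<T> p q * (s p - s q)\<^sup>2)"
    by (intro sum_nonneg stiffness_term_nonneg assms) auto
  moreover have "(real CARD('d) - 1) / (4 * real CARD('d)) \<ge> 0"
    using zero_less_card_finite[where 'a='d] by (simp add: Suc_le_eq)
  ultimately show ?thesis by (simp add: E_uni_m_def)
qed

lemma E_uni_m_nonneg:
  assumes "weakly_acute \<Omega> \<T>" shows "0 \<le> E_uni_m \<Omega> \<T> s V"
  using E_uni_i_nonneg[OF assms] E_uni_i_le_E_uni_m[OF assms] by (rule order_trans)

lemma nonneg_quadratic_discriminant:
  fixes a b c :: real
  assumes "\<And>r. 0 \<le> a + r * (2 * b) + r\<^sup>2 * c" and "c \<ge> 0"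
  shows "b\<^sup>2 \<le> a * c"
proof (cases "c = 0")
  case True
  then show ?thesis using assms(1)[of "- (a + 1) / (2 * b)"] assms(1)[of 0] by (cases "b = 0") auto
next
  case False
  then have "c > 0" using \<open>c \<ge> 0\<close> by simp
  then have "0 \<le> (a + (- b / c) * (2 * b) + (- b / c)\<^sup>2 * c) * c"
    using assms(1)[of "- b / c"] by (intro mult_nonneg_nonneg) auto
  also have "\<dots> = a * c - b\<^sup>2"
    using \<open>c > 0\<close> by (simp add: field_simps power2_eq_square)
  finally show ?thesis by simp
qed

lemma E_uni_i_Cauchy_Schwarz:
  assumes "weakly_acute \<Omega> \<T>"
  shows "(E_uni_i_form \<Omega> \<T> s V W)\<^sup>2 \<le> E_uni_i \<Omega> \<T> s V * E_uni_i \<Omega> \<T> s W"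
proof (rule nonneg_quadratic_discriminant)
  show "0 \<le> E_uni_i \<Omega> \<T> s V + r * (2 * E_uni_i_form \<Omega> \<T> s V W) + r\<^sup>2 * E_uni_i \<Omega> \<T> s W" for r
    unfolding E_uni_i_add_scaled[symmetric] by (rule E_uni_i_nonneg[OF assms])
qed (rule E_uni_i_nonneg[OF assms])

section \<open>The director step\<close>

text \<open>The first factor bounds stiffness sums by weighted Dirichlet integrals, the second bounds
  squared nodal values by \<open>h ^ (-d)\<close> times the squared \<open>L\<^sup>2\<close> norm.\<close>

definition inverse_constant :: "'d::finite itself \<Rightarrow> real \<Rightarrow> real \<Rightarrow> real" where
  "inverse_constant _ \<sigma> \<kappa> = (real (CARD('d) + 1))\<^sup>2 * (\<sigma>\<^sup>2 * 4 ^ (CARD('d) + 1)) *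
     (4 ^ (CARD('d) + 1) * (2 * \<sigma> * \<kappa>) ^ CARD('d) / measure lebesgue (ball (0::real^'d) 1))"

lemma inverse_constant_pos:
  assumes "\<sigma> > 0" "\<kappa> > 0"
  shows "inverse_constant TYPE('d::finite) \<sigma> \<kappa> > 0"
proof -
  have "measure lebesgue (ball (0::real^'d) 1) > 0"
    using content_ball_pos[of 1 "0::real^'d"] by simp
  then show ?thesis using assms by (simp add: inverse_constant_def)
qed

context simplicial_mesh
begin

text \<open>Differences of the squares are at most twice the maximal nodal value of \<open>t\<close> times the
  differences of \<open>t\<close>.  The square of this maximum is bounded by \<open>nodal_value_le_L2\<close> and the
  remaining sum by \<open>stiffness_weighted_difference_le\<close>.\<close>

lemma E_uni_i_square_le:
  fixes t :: "real^'d \<Rightarrow> real^'d"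
  assumes \<sigma>: "shape_regular \<sigma> \<T>" and \<kappa>: "quasi_uniform \<kappa> \<T>"
    and t: "t \<in> fe_space \<T>" and s: "s \<in> fe_space \<T>"
  shows "E_uni_i \<Omega> \<T> s (\<lambda>x. t x \<otimes>\<^sub>t t x)
    \<le> inverse_constant TYPE('d) \<sigma> \<kappa> / mesh_size \<T> ^ CARD('d) *
      (LINT x:\<Omega>|lebesgue. (norm (t x))\<^sup>2) *
      (LINT x:\<Omega>|lebesgue. (norm (jacobian t (at x)))\<^sup>2 * (s x)\<^sup>2)"
proof -
  define X where "X = (LINT x:\<Omega>|lebesgue. (norm (t x))\<^sup>2)"
  define Y where "Y = (LINT x:\<Omega>|lebesgue. (norm (jacobian t (at x)))\<^sup>2 * (s x)\<^sup>2)"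
  define \<omega> where "\<omega> = measure lebesgue (ball (0::real^'d) 1)"
  define m where "m = (mesh_size \<T> / (2 * \<sigma> * \<kappa>)) ^ CARD('d) * \<omega>"
  define M where "M = sqrt (4 ^ (CARD('d) + 1) * X / m)"
  define S where "S = (\<Sum>p\<in>nodes \<T>. \<Sum>q\<in>nodes \<T>.
      \<bar>stiffness \<Omega> \<T> p q\<bar> * (((s p)\<^sup>2 + (s q)\<^sup>2) / 2) * (norm (t p - t q))\<^sup>2)"
  have pos: "\<sigma> > 0" "\<kappa> > 0" "mesh_size \<T> > 0" "\<omega> > 0"
    using shape_regular_pos[OF \<sigma>] quasi_uniform_pos[OF \<kappa>] mesh_size_pos
      content_ball_pos[of 1 "0::real^'d"] by (simp_all add: \<omega>_def)
  have m: "m > 0" using pos by (simp add: m_def)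
  have X: "X \<ge> 0" unfolding X_def set_lebesgue_integral_def
    by (intro Bochner_Integration.integral_nonneg) simp
  have M2: "M\<^sup>2 = 4 ^ (CARD('d) + 1) * X / m" "M \<ge> 0"
    using X m by (simp_all add: M_def)
  have tM: "norm (t p) \<le> M" if "p \<in> nodes \<T>" for p
  proof -
    have "(norm (t p))\<^sup>2 * m \<le> 4 ^ (CARD('d) + 1) * X"
      using nodal_value_le_L2[OF t \<sigma> \<kappa> that] by (simp add: m_def X_def \<omega>_def)
    then have "(norm (t p))\<^sup>2 \<le> M\<^sup>2" using m by (simp add: M2 field_simps)
    then show ?thesis using M2(2) by (rule power2_le_imp_le)
  qed
  have "E_uni_i \<Omega> \<T> s (\<lambda>x. t x \<otimes>\<^sub>t t x) \<le> 1/4 * (\<Sum>p\<in>nodes \<T>. \<Sum>q\<in>nodes \<T>.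
      (4 * M\<^sup>2) * (\<bar>stiffness \<Omega> \<T> p q\<bar> * (((s p)\<^sup>2 + (s q)\<^sup>2) / 2) * (norm (t p - t q))\<^sup>2))"
    unfolding E_uni_i_def
  proof (intro mult_left_mono sum_mono)
    fix p q assume pq: "p \<in> nodes \<T>" "q \<in> nodes \<T>"
    have "(norm (t p \<otimes>\<^sub>t t p - t q \<otimes>\<^sub>t t q))\<^sup>2 \<le> (2 * M * norm (t p - t q))\<^sup>2"
      using norm_tensor_diff_le[OF tM[OF pq(1)] tM[OF pq(2)]] by (intro power_mono) auto
    then have "\<bar>stiffness \<Omega> \<T> p q\<bar> * (((s p)\<^sup>2 + (s q)\<^sup>2) / 2) * (norm (t p \<otimes>\<^sub>t t p - t q \<otimes>\<^sub>t t q))\<^sup>2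
      \<le> \<bar>stiffness \<Omega> \<T> p q\<bar> * (((s p)\<^sup>2 + (s q)\<^sup>2) / 2) * (2 * M * norm (t p - t q))\<^sup>2"
      by (intro mult_left_mono) auto
    moreover have "stiffness \<Omega> \<T> p q * (((s p)\<^sup>2 + (s q)\<^sup>2) / 2) * (norm (t p \<otimes>\<^sub>t t p - t q \<otimes>\<^sub>t t q))\<^sup>2
      \<le> \<bar>stiffness \<Omega> \<T> p q\<bar> * (((s p)\<^sup>2 + (s q)\<^sup>2) / 2) * (norm (t p \<otimes>\<^sub>t t p - t q \<otimes>\<^sub>t t q))\<^sup>2"
      by (intro mult_right_mono) auto
    ultimately show "stiffness \<Omega> \<T> p q * (((s p)\<^sup>2 + (s q)\<^sup>2) / 2) * (norm (t p \<otimes>\<^sub>t t p - t q \<otimes>\<^sub>t t q))\<^sup>2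
      \<le> (4 * M\<^sup>2) * (\<bar>stiffness \<Omega> \<T> p q\<bar> * (((s p)\<^sup>2 + (s q)\<^sup>2) / 2) * (norm (t p - t q))\<^sup>2)"
      by (simp add: power_mult_distrib mult_ac)
  qed simp
  also have "\<dots> = M\<^sup>2 * S"
    by (simp only: S_def sum_distrib_left[symmetric])
  also have "\<dots> \<le> M\<^sup>2 * ((real (CARD('d) + 1))\<^sup>2 * (\<sigma>\<^sup>2 * 4 ^ (CARD('d) + 1)) * Y)"
    unfolding S_def Y_def
    by (intro mult_left_mono stiffness_weighted_difference_le[OF t s \<sigma>]) simp
  also have "\<dots> = inverse_constant TYPE('d) \<sigma> \<kappa> / mesh_size \<T> ^ CARD('d) * X * Y"
    unfolding M2 m_def inverse_constant_def \<omega>_def[symmetric]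
    using pos by (simp add: power_divide field_simps)
  finally show ?thesis unfolding X_def Y_def .
qed

lemma H1_weighted_norm_sq:
  assumes "t \<in> fe_space \<T>" "s \<in> fe_space \<T>"
  shows "(H1_weighted_norm \<Omega> (\<lambda>x. (s x)\<^sup>2) t)\<^sup>2 = (LINT x:\<Omega>|lebesgue. (norm (t x))\<^sup>2) +
     (LINT x:\<Omega>|lebesgue. (norm (jacobian t (at x)))\<^sup>2 * (s x)\<^sup>2)"
proof -
  have "0 \<le> (LINT x:\<Omega>|lebesgue. (norm (t x))\<^sup>2)"
    "0 \<le> (LINT x:\<Omega>|lebesgue. (norm (jacobian t (at x)))\<^sup>2 * (s x)\<^sup>2)"
    unfolding set_lebesgue_integral_def by (intro Bochner_Integration.integral_nonneg; simp)+
  then show ?thesis unfolding H1_weighted_norm_def by simp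
qed

text \<open>With \<open>V\<close> the field \<open>\<Theta> + T\<close>, where \<open>T\<close> is the tangential correction of the step, testing
  the equation of the step with its own solution gives \<open>E V + N / \<tau> \<le> E \<Theta>\<close>, where \<open>E\<close> is the
  energy and \<open>N\<close> the squared norm of \<open>t\<close>.
  At the nodes, \<open>V\<close> differs from the rank-one matrix generated by \<open>n + t\<close> only by the square
  of \<open>t\<close>.  Since \<open>t\<close> is orthogonal to \<open>n\<close>, the vector \<open>n + t\<close> has length at least 1, so the
  normalisation does not increase the energy.  Hence \<open>E \<Theta>' \<le> E V + 2 * F + D\<close>, where \<open>D\<close> is the
  energy of the square of \<open>t\<close>, of order \<open>N\<^sup>2 / h ^ d\<close>, and \<open>F\<close> is the mixed term, which
  Cauchy-Schwarz controls by \<open>sqrt (E V * D)\<close>.  The step size condition makes \<open>2 * F + D\<close> at most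
  \<open>(2/5 + 1/25) * N / \<tau>\<close>, which leaves more than half of the dissipation \<open>N / \<tau>\<close>.\<close>

lemma director_step_energy_decay:
  assumes acute: "weakly_acute \<Omega> \<T>" and \<sigma>: "shape_regular \<sigma> \<T>" and \<kappa>: "quasi_uniform \<kappa> \<T>"
    and s: "s \<in> fe_space \<T>" and n: "\<And>p. p \<in> nodes \<T> \<Longrightarrow> norm (n p) = 1"
    and \<Theta>: "\<And>p. p \<in> nodes \<T> \<Longrightarrow> \<Theta> p = n p \<otimes>\<^sub>t n p"
    and n': "\<And>p. p \<in> nodes \<T> \<Longrightarrow> n' p = (n p + t p) /\<^sub>R norm (n p + t p)"
    and \<Theta>': "\<And>p. p \<in> nodes \<T> \<Longrightarrow> \<Theta>' p = n' p \<otimes>\<^sub>t n' p"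
    and step: "tangent_step \<Omega> \<T> \<Gamma> \<tau> s \<Theta> n t"
    and \<tau>: "\<tau> > 0" and E: "E_uni_i \<Omega> \<T> s \<Theta> \<le> E\<^sub>0"
    and small: "25 * inverse_constant TYPE('d) \<sigma> \<kappa> * (\<tau>\<^sup>2 * E\<^sub>0) \<le> mesh_size \<T> ^ CARD('d)"
  shows "E_uni_i \<Omega> \<T> s \<Theta>' + 1 / (2 * \<tau>) * (H1_weighted_norm \<Omega> (\<lambda>x. (s x)\<^sup>2) t)\<^sup>2 \<le> E_uni_i \<Omega> \<T> s \<Theta>"
proof -
  define K where "K = inverse_constant TYPE('d) \<sigma> \<kappa>"
  define H where "H = mesh_size \<T> ^ CARD('d)"
  define T where "T = tangent_field \<T> n t"
  define N where "N = (H1_weighted_norm \<Omega> (\<lambda>x. (s x)\<^sup>2) t)\<^sup>2"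
  define P where "P = E_uni_i \<Omega> \<T> s (\<lambda>x. \<Theta> x + T x)"
  define D where "D = E_uni_i \<Omega> \<T> s (\<lambda>x. t x \<otimes>\<^sub>t t x)"
  define F where "F = E_uni_i_form \<Omega> \<T> s (\<lambda>x. \<Theta> x + T x) (\<lambda>x. t x \<otimes>\<^sub>t t x)"
  have t: "t \<in> fe_space \<T>" "t \<in> tangent_space \<T> \<Gamma> n"
    and tn: "\<And>p. p \<in> nodes \<T> \<Longrightarrow> t p \<bullet> n p = 0"
    using step by (auto simp: tangent_step_def tangent_space_def)
  have K: "K > 0" and H: "H > 0"
    using inverse_constant_pos[OF shape_regular_pos[OF \<sigma>] quasi_uniform_pos[OF \<kappa>]] mesh_size_pos
    by (simp_all add: K_def H_def)
  have N_eq: "N = (LINT x:\<Omega>|lebesgue. t x \<bullet> t x +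
      (jacobian t (at x) \<bullet> jacobian t (at x)) * \<bar>s x\<bar>\<^sup>2)"
  proof -
    have "set_integrable lebesgue \<Omega> (\<lambda>x. (norm (t x))\<^sup>2)"
      by (intro set_integrable_continuous continuous_intros fe_space_continuous t)
    moreover have "set_integrable lebesgue \<Omega> (\<lambda>x. (norm (jacobian t (at x)))\<^sup>2 * (s x)\<^sup>2)"
      by (intro set_integrable_jacobian t continuous_intros fe_space_continuous s)
    ultimately show ?thesis
      unfolding N_def H1_weighted_norm_sq[OF t(1) s] by (simp add: power2_norm_eq_inner)
  qed
  have "1 / \<tau> * N + var_Theta_E_uni_i \<Omega> \<T> s (\<lambda>x. \<Theta> x + T x) T = 0"
    using step t(2) unfolding tangent_step_def N_eq T_def by blast
  \<comment> \<open>The quadratic energy at \<open>\<Theta>\<close>, expanded around \<open>\<Theta> + T\<close>.\<close>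
  moreover have "E_uni_i \<Omega> \<T> s \<Theta> = P + E_uni_i \<Omega> \<T> s T - var_Theta_E_uni_i \<Omega> \<T> s (\<lambda>x. \<Theta> x + T x) T"
    using E_uni_i_add_scaled[of \<Omega> \<T> s "\<lambda>x. \<Theta> x + T x" "-1" T]
    by (simp add: var_Theta_E_uni_i_eq P_def)
  ultimately have energy: "P + N / \<tau> \<le> E_uni_i \<Omega> \<T> s \<Theta>"
    using E_uni_i_nonneg[OF acute, of s T] by simp
  have "E_uni_i \<Omega> \<T> s \<Theta>' \<le> E_uni_i \<Omega> \<T> s (\<lambda>x. (\<Theta> x + T x) + t x \<otimes>\<^sub>t t x)"
  proof (rule E_uni_i_mono[OF acute])
    have hat: "\<Theta> p + T p + t p \<otimes>\<^sub>t t p = (n p + t p) \<otimes>\<^sub>t (n p + t p)" if "p \<in> nodes \<T>" for p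
      using that by (simp add: \<Theta> T_def tangent_field_def interp_node tensor_algebra)
    have len: "norm ((n p + t p) \<otimes>\<^sub>t (n p + t p)) \<ge> 1" if "p \<in> nodes \<T>" for p
    proof -
      have "(norm (n p + t p))\<^sup>2 = 1 + (norm (t p))\<^sup>2"
        using tn[OF that] n[OF that] norm_eq_1[of "n p"]
        by (simp add: power2_norm_eq_inner inner_add_left inner_add_right inner_commute)
      then show ?thesis by (simp add: norm_tensor power2_eq_square)
    qed
    have proj: "\<Theta>' p = (\<Theta> p + T p + t p \<otimes>\<^sub>t t p) /\<^sub>R norm (\<Theta> p + T p + t p \<otimes>\<^sub>t t p)"
      if "p \<in> nodes \<T>" for p
      unfolding hat[OF that] \<Theta>'[OF that] n'[OF that] norm_tensor
      by (simp only: tensor_algebra(5,6) scaleR_scaleR inverse_mult_distrib)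
    fix p q assume "p \<in> nodes \<T>" "q \<in> nodes \<T>"
    then show "norm (\<Theta>' p - \<Theta>' q)
      \<le> norm ((\<Theta> p + T p + t p \<otimes>\<^sub>t t p) - (\<Theta> q + T q + t q \<otimes>\<^sub>t t q))"
      using len hat by (simp only: proj) (intro norm_normalize_diff_le; simp)
  qed
  also have "\<dots> = P + 2 * F + D"
    unfolding P_def F_def D_def by (rule E_uni_i_add)
  finally have update: "E_uni_i \<Omega> \<T> s \<Theta>' \<le> P + 2 * F + D" .
  have nonneg: "0 \<le> N" "0 \<le> P" "0 \<le> D"
    using E_uni_i_nonneg[OF acute] by (simp_all add: N_def P_def D_def)
  have "N / \<tau> \<le> E\<^sub>0" "P \<le> E\<^sub>0"
    using energy nonneg E \<tau> divide_nonneg_pos[of N \<tau>] by linarith+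
  have D_le: "D \<le> K / H * N\<^sup>2"
  proof -
    define X where "X = (LINT x:\<Omega>|lebesgue. (norm (t x))\<^sup>2)"
    define Y where "Y = (LINT x:\<Omega>|lebesgue. (norm (jacobian t (at x)))\<^sup>2 * (s x)\<^sup>2)"
    have XY: "X \<ge> 0" "Y \<ge> 0" "N = X + Y"
      unfolding X_def Y_def N_def H1_weighted_norm_sq[OF t(1) s] set_lebesgue_integral_def
      by (auto intro!: Bochner_Integration.integral_nonneg)
    have "D \<le> K / H * X * Y"
      using E_uni_i_square_le[OF \<sigma> \<kappa> t(1) s] by (simp add: D_def K_def H_def X_def Y_def)
    also have "\<dots> = K / H * (X * Y)" by simp
    also have "X * Y \<le> N\<^sup>2"
      using XY by (simp add: power2_eq_square algebra_simps)
    finally show ?thesis using K H by (simp add: divide_right_mono)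
  qed
  have small': "K * E\<^sub>0 / H \<le> 1 / (25 * \<tau>\<^sup>2)"
    using small \<tau> H by (simp add: K_def[symmetric] H_def[symmetric] field_simps)
  have E0: "0 \<le> E\<^sub>0" using \<open>P \<le> E\<^sub>0\<close> nonneg by simp
  have "D \<le> 1 / 25 * (N / \<tau>)"
  proof -
    have "K / H * (\<tau> * (\<tau> * E\<^sub>0)) = K * E\<^sub>0 / H * \<tau>\<^sup>2" by (simp add: power2_eq_square)
    also have "\<dots> \<le> 1 / (25 * \<tau>\<^sup>2) * \<tau>\<^sup>2"
      by (intro mult_right_mono small') simp
    also have "\<dots> = 1 / 25" using \<tau> by simp
    finally have coeff: "K / H * (\<tau> * (\<tau> * E\<^sub>0)) \<le> 1 / 25" .
    have "K / H * N\<^sup>2 = (K / H * (\<tau> * N)) * (N / \<tau>)"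
      using \<tau> by (simp add: power2_eq_square)
    also have "\<dots> \<le> (K / H * (\<tau> * (\<tau> * E\<^sub>0))) * (N / \<tau>)"
      using \<open>N / \<tau> \<le> E\<^sub>0\<close> \<tau> K H nonneg
      by (intro mult_right_mono mult_left_mono) (auto simp: field_simps)
    also have "\<dots> \<le> 1 / 25 * (N / \<tau>)"
      using nonneg \<tau> by (intro mult_right_mono coeff) simp
    finally have "K / H * N\<^sup>2 \<le> 1 / 25 * (N / \<tau>)" .
    with D_le show ?thesis by (rule order_trans)
  qed
  moreover have "F \<le> 1 / 5 * (N / \<tau>)"
  proof (rule power2_le_imp_le)
    have "F\<^sup>2 \<le> P * D"
      unfolding F_def P_def D_def by (rule E_uni_i_Cauchy_Schwarz[OF acute])
    also have "\<dots> \<le> E\<^sub>0 * (K / H * N\<^sup>2)"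
      using \<open>P \<le> E\<^sub>0\<close> D_le nonneg E0 by (intro mult_mono) auto
    also have "\<dots> = K * E\<^sub>0 / H * N\<^sup>2" by simp
    also have "\<dots> \<le> 1 / (25 * \<tau>\<^sup>2) * N\<^sup>2"
      by (intro mult_right_mono small') simp
    also have "\<dots> = (1 / 5 * (N / \<tau>))\<^sup>2" by (simp add: power_mult_distrib power_divide)
    finally show "F\<^sup>2 \<le> (1 / 5 * (N / \<tau>))\<^sup>2" .
  qed (use nonneg \<tau> in simp)
  moreover have "0 \<le> N / \<tau>" using nonneg \<tau> by simp
  ultimately have "P + 2 * F + D + 1/2 * (N / \<tau>) \<le> P + N / \<tau>" by linarith
  then show ?thesis using update energy by (simp add: N_def)
qed

end

section \<open>The order parameter step\<close>

lemma convex_above_tangent: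
  fixes f :: "real \<Rightarrow> real"
  assumes "convex_on UNIV f" "\<And>r. f differentiable (at r)"
  shows "deriv f x * (y - x) \<le> f y - f x"
proof -
  have "(f has_field_derivative deriv f x) (at x)"
    using assms(2)[of x] by (simp add: DERIV_deriv_iff_real_differentiable)
  then show ?thesis
    using convex_on_imp_above_tangent[OF assms(1), of x y "deriv f x"] by simp
qed

lemma convex_deriv_mono:
  fixes f :: "real \<Rightarrow> real"
  assumes "convex_on UNIV f" "\<And>r. f differentiable (at r)"
  shows "mono (deriv f)"
proof (rule monoI)
  fix x y :: real assume "x \<le> y"
  have "deriv f x * (y - x) \<le> deriv f y * (y - x)"
    using convex_above_tangent[OF assms, of x y] convex_above_tangent[OF assms, of y x]
    by (simp add: algebra_simps)
  then show "deriv f x \<le> deriv f y"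
    using \<open>x \<le> y\<close> by (cases "x = y") (auto simp: mult_le_cancel_right)
qed

context simplicial_mesh
begin

lemma compact_Union_mesh: "compact (\<Union>\<T>)"
  using open_domain(2) by (simp add: Union_mesh)

lemma continuous_bounded_on_mesh:
  fixes u :: "real^'d \<Rightarrow> real"
  assumes "continuous_on (\<Union>\<T>) u"
  obtains B where "\<And>x. x \<in> \<Omega> \<Longrightarrow> \<bar>u x\<bar> \<le> B"
proof -
  have "bounded (u ` \<Union>\<T>)"
    by (intro compact_imp_bounded compact_continuous_image assms compact_Union_mesh)
  then obtain B where B: "\<And>y. y \<in> u ` \<Union>\<T> \<Longrightarrow> norm y \<le> B" by (auto simp: bounded_iff)
  have "\<Omega> \<subseteq> \<Union>\<T>" using closure_subset Union_mesh by metis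
  then show thesis using B by (intro that[of B]) auto
qed

text \<open>Monotone functions are Borel measurable and bounded on bounded sets.  The derivatives of the
  convex functions in the splitting are of this kind.\<close>

lemma set_integrable_mono_compose:
  fixes u v :: "real^'d \<Rightarrow> real"
  assumes "mono h" and u: "continuous_on (\<Union>\<T>) u" and v: "continuous_on (\<Union>\<T>) v"
  shows "set_integrable lebesgue \<Omega> (\<lambda>x. h (u x) * v x)"
proof -
  obtain B where B: "\<And>x. x \<in> \<Omega> \<Longrightarrow> \<bar>u x\<bar> \<le> B" using continuous_bounded_on_mesh[OF u] by blast
  obtain B' where B': "\<And>x. x \<in> \<Omega> \<Longrightarrow> \<bar>v x\<bar> \<le> B'" using continuous_bounded_on_mesh[OF v] by blast
  have h: "h \<in> borel_measurable borel" using \<open>mono h\<close> by (rule borel_measurable_mono)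
  have m: "(\<lambda>x. indicator \<Omega> x * w x) \<in> borel_measurable lebesgue"
    if "continuous_on (\<Union>\<T>) w" for w :: "real^'d \<Rightarrow> real"
    using set_integrable_continuous[OF that] by (auto simp: set_integrable_def)
  show ?thesis
  proof (rule set_integrable_bound)
    show "set_integrable lebesgue \<Omega> (\<lambda>_. (\<bar>h B\<bar> + \<bar>h (- B)\<bar>) * B')"
      by (intro set_integrable_continuous continuous_on_const)
    have "(\<lambda>x. h (indicator \<Omega> x * u x) * (indicator \<Omega> x * v x)) \<in> borel_measurable lebesgue"
      by (intro borel_measurable_times m v measurable_compose[OF m h] u)
    moreover have "(\<lambda>x. h (indicator \<Omega> x * u x) * (indicator \<Omega> x * v x))
      = (\<lambda>x. indicator \<Omega> x *\<^sub>R (h (u x) * v x))"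
      by (auto simp: indicator_def)
    ultimately show "set_borel_measurable lebesgue \<Omega> (\<lambda>x. h (u x) * v x)"
      by (simp add: set_borel_measurable_def)
    show "AE x in lebesgue. x \<in> \<Omega> \<longrightarrow> norm (h (u x) * v x) \<le> norm ((\<bar>h B\<bar> + \<bar>h (- B)\<bar>) * B')"
    proof (rule AE_I2, rule impI)
      fix x assume x: "x \<in> \<Omega>"
      have "- B \<le> u x" "u x \<le> B" using B[OF x] by auto
      then have "h (- B) \<le> h (u x)" "h (u x) \<le> h B" using \<open>mono h\<close> by (auto dest: monoD)
      then have "\<bar>h (u x)\<bar> \<le> \<bar>h B\<bar> + \<bar>h (- B)\<bar>" by linarith
      then have "\<bar>h (u x)\<bar> * \<bar>v x\<bar> \<le> (\<bar>h B\<bar> + \<bar>h (- B)\<bar>) * B'"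
        using B'[OF x] by (intro mult_mono) auto
      then show "norm (h (u x) * v x) \<le> norm ((\<bar>h B\<bar> + \<bar>h (- B)\<bar>) * B')"
        unfolding real_norm_def abs_mult[of "h (u x)"] by linarith
    qed
  qed
qed

lemma fe_space_diff:
  fixes u v :: "real^'d \<Rightarrow> 'b::euclidean_space"
  assumes "u \<in> fe_space \<T>" "v \<in> fe_space \<T>"
  shows "(\<lambda>x. u x - v x) \<in> fe_space \<T>"
proof -
  have "\<exists>L b. linear L \<and> (\<forall>x\<in>T. u x - v x = L x + b)" if "T \<in> \<T>" for T
  proof -
    obtain L b where L: "linear L" "\<And>x. x \<in> T \<Longrightarrow> u x = L x + b"
      using fe_space_affine[OF assms(1) \<open>T \<in> \<T>\<close>] by blast
    obtain L' b' where L': "linear L'" "\<And>x. x \<in> T \<Longrightarrow> v x = L' x + b'"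
      using fe_space_affine[OF assms(2) \<open>T \<in> \<T>\<close>] by blast
    show ?thesis
      using linear_compose_sub[OF L(1) L'(1)] L(2) L'(2)
      by (intro exI[of _ "\<lambda>x. L x - L' x"] exI[of _ "b - b'"]) auto
  qed
  moreover have "continuous_on (\<Union>\<T>) (\<lambda>x. u x - v x)"
    by (intro continuous_intros fe_space_continuous assms)
  ultimately show ?thesis by (simp add: fe_space_def)
qed

text \<open>The increment \<open>z\<close> vanishes on \<open>\<Gamma>\<close> and is therefore a test function.  The tangent of \<open>\<psi>\<^sub>c\<close> at
  the new value and that of \<open>\<psi>\<^sub>e\<close> at the old value lie below the graphs, so the term from the
  convex splitting bounds the increase of \<open>\<psi>\<close>.\<close>

lemma order_step_energy_decay:
  assumes s: "s \<in> fe_space_bc \<T> \<Gamma> g"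
    and step: "order_step \<Omega> \<T> \<Gamma> \<tau> \<eta> \<psi>\<^sub>c \<psi>\<^sub>e g s \<Theta> s'"
    and acute: "weakly_acute \<Omega> \<T>" and \<eta>: "\<eta> > 0"
    and c: "convex_on UNIV \<psi>\<^sub>c" "\<And>r. \<psi>\<^sub>c differentiable (at r)"
    and e: "convex_on UNIV \<psi>\<^sub>e" "\<And>r. \<psi>\<^sub>e differentiable (at r)"
    and split: "\<And>r. \<psi> r = \<psi>\<^sub>c r - \<psi>\<^sub>e r"
  shows "E_uni_t \<Omega> \<T> \<eta> \<psi> s' \<Theta> + 1 / \<tau> * (L2_norm_on \<Omega> (\<lambda>x. s' x - s x))\<^sup>2 \<le> E_uni_t \<Omega> \<T> \<eta> \<psi> s \<Theta>"
proof -
  define z where "z = (\<lambda>x. s' x - s x)"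
  have s': "s' \<in> fe_space \<T>" "\<And>x. x \<in> \<Gamma> \<Longrightarrow> s' x = g x"
    and s_fe: "s \<in> fe_space \<T>" "\<And>x. x \<in> \<Gamma> \<Longrightarrow> s x = g x"
    using s step by (auto simp: order_step_def fe_space_bc_def)
  have z: "z \<in> fe_space \<T>" unfolding z_def by (rule fe_space_diff[OF s'(1) s_fe(1)])
  have z0: "z \<in> fe_space_bc \<T> \<Gamma> (\<lambda>x. 0)"
    using z s'(2) s_fe(2) by (simp add: fe_space_bc_def z_def)
  note cont = fe_space_continuous[OF s'(1)] fe_space_continuous[OF s_fe(1)] fe_space_continuous[OF z]
  define I where "I = (LINT x:\<Omega>|lebesgue. (deriv \<psi>\<^sub>c (s' x) - deriv \<psi>\<^sub>e (s x)) * z x)"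
  have "(LINT x:\<Omega>|lebesgue. (s' x - s x) * z x) = (L2_norm_on \<Omega> z)\<^sup>2"
  proof -
    have "0 \<le> (LINT x:\<Omega>|lebesgue. (z x)\<^sup>2)"
      unfolding set_lebesgue_integral_def by (intro Bochner_Integration.integral_nonneg) simp
    then show ?thesis by (simp add: L2_norm_on_def) (simp add: z_def power2_eq_square)
  qed
  moreover have "1 / \<tau> * (LINT x:\<Omega>|lebesgue. (s' x - s x) * z x) + var_s_E_uni_m \<Omega> \<T> s' \<Theta> z + 1 / \<eta> * I = 0"
    using step z0 unfolding order_step_def I_def by blast
  ultimately have *: "1 / \<tau> * (L2_norm_on \<Omega> z)\<^sup>2 + var_s_E_uni_m \<Omega> \<T> s' \<Theta> z + 1 / \<eta> * I = 0"
    by simp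
  have \<psi>_cont: "continuous_on UNIV \<psi>"
  proof -
    have "continuous_on UNIV \<psi>\<^sub>c" "continuous_on UNIV \<psi>\<^sub>e"
      using c(2) e(2) by (auto intro!: differentiable_imp_continuous_on
          simp: differentiable_on_def)
    then have "continuous_on UNIV (\<lambda>r. \<psi>\<^sub>c r - \<psi>\<^sub>e r)" by (rule continuous_on_diff)
    then show ?thesis using split by (simp cong: continuous_on_cong)
  qed
  have \<psi>_int: "set_integrable lebesgue \<Omega> (\<lambda>x. \<psi> (u x))" if "continuous_on (\<Union>\<T>) u" for u
    by (rule set_integrable_continuous) (rule continuous_on_compose2[OF \<psi>_cont that], simp)
  have "(LINT x:\<Omega>|lebesgue. \<psi> (s' x)) - (LINT x:\<Omega>|lebesgue. \<psi> (s x))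
      = (LINT x:\<Omega>|lebesgue. \<psi> (s' x) - \<psi> (s x))"
    by (intro set_integral_diff(2)[symmetric] \<psi>_int cont)
  also have "\<dots> \<le> (LINT x:\<Omega>|lebesgue. deriv \<psi>\<^sub>c (s' x) * z x - deriv \<psi>\<^sub>e (s x) * z x)"
  proof (rule set_integral_mono)
    show "set_integrable lebesgue \<Omega> (\<lambda>x. \<psi> (s' x) - \<psi> (s x))"
      by (intro set_integral_diff(1) \<psi>_int cont)
    show "set_integrable lebesgue \<Omega> (\<lambda>x. deriv \<psi>\<^sub>c (s' x) * z x - deriv \<psi>\<^sub>e (s x) * z x)"
      by (intro set_integral_diff(1) set_integrable_mono_compose cont convex_deriv_mono c e)
    show "\<psi> (s' x) - \<psi> (s x) \<le> deriv \<psi>\<^sub>c (s' x) * z x - deriv \<psi>\<^sub>e (s x) * z x" for x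
      using convex_above_tangent[OF c, of "s' x" "s x"] convex_above_tangent[OF e, of "s x" "s' x"]
      by (simp add: split z_def algebra_simps)
  qed
  also have "\<dots> = I" by (simp add: I_def left_diff_distrib)
  finally have "E_bulk \<Omega> \<eta> \<psi> s' - E_bulk \<Omega> \<eta> \<psi> s \<le> 1 / \<eta> * I"
    using \<eta> by (simp add: E_bulk_def divide_right_mono flip: diff_divide_distrib)
  moreover have "var_s_E_uni_m \<Omega> \<T> s' \<Theta> z \<ge> E_uni_m \<Omega> \<T> s' \<Theta> - E_uni_m \<Omega> \<T> s \<Theta>"
    unfolding z_def var_s_E_uni_m_increment using E_uni_m_nonneg[OF acute] by simp
  ultimately show ?thesis using * unfolding E_uni_t_def z_def by linarith
qed

lemma E_bulk_nonneg:
  assumes "\<eta> > 0" "\<And>r. \<psi> r \<ge> 0"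
  shows "0 \<le> E_bulk \<Omega> \<eta> \<psi> s"
  unfolding E_bulk_def set_lebesgue_integral_def
  using assms by (intro mult_nonneg_nonneg Bochner_Integration.integral_nonneg) auto

text \<open>The two decay estimates add up, because the director step changes only the second argument
  of the energy and the other step only the first.\<close>

lemma gradient_flow_energy_step:
  assumes flow: "gradient_flow \<Omega> \<T> \<Gamma>\<^sub>s \<Gamma>\<^sub>\<Theta> \<tau> \<eta> \<psi>\<^sub>c \<psi>\<^sub>e g s \<Theta> n t" and s0: "s 0 \<in> fe_space_bc \<T> \<Gamma>\<^sub>s g"
    and acute: "weakly_acute \<Omega> \<T>" and \<sigma>: "shape_regular \<sigma> \<T>" and \<kappa>: "quasi_uniform \<kappa> \<T>"
    and pos: "\<eta> > 0" "\<tau> > 0"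
    and c: "convex_on UNIV \<psi>\<^sub>c" "\<And>r. \<psi>\<^sub>c differentiable (at r)"
    and e: "convex_on UNIV \<psi>\<^sub>e" "\<And>r. \<psi>\<^sub>e differentiable (at r)"
    and split: "\<And>r. \<psi> r = \<psi>\<^sub>c r - \<psi>\<^sub>e r" and \<psi>: "\<And>r. \<psi> r \<ge> 0"
    and E: "E_uni_t \<Omega> \<T> \<eta> \<psi> (s k) (\<Theta> k) \<le> E\<^sub>0"
    and small: "25 * inverse_constant TYPE('d) \<sigma> \<kappa> * (\<tau>\<^sup>2 * E\<^sub>0) \<le> mesh_size \<T> ^ CARD('d)"
  shows "E_uni_t \<Omega> \<T> \<eta> \<psi> (s (Suc k)) (\<Theta> (Suc k)) +
      1 / (2 * \<tau>) * ((H1_weighted_norm \<Omega> (\<lambda>x. (s k x)\<^sup>2) (t k))\<^sup>2 +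
        (L2_norm_on \<Omega> (\<lambda>x. s (Suc k) x - s k x))\<^sup>2)
    \<le> E_uni_t \<Omega> \<T> \<eta> \<psi> (s k) (\<Theta> k)"
proof -
  note flow' = flow[unfolded gradient_flow_def, rule_format]
  have s: "s k \<in> fe_space_bc \<T> \<Gamma>\<^sub>s g"
    using s0 flow'[of "k - 1"] by (cases k) (auto simp: order_step_def)
  then have s_fe: "s k \<in> fe_space \<T>" by (simp add: fe_space_bc_def)
  have bulk: "0 \<le> E_bulk \<Omega> \<eta> \<psi> (s k)"
    using pos(1) \<psi> by (rule E_bulk_nonneg)
  have "E_uni_i \<Omega> \<T> (s k) (\<Theta> k) \<le> E\<^sub>0"
    using E bulk E_uni_i_le_E_uni_m[OF acute, of "s k" "\<Theta> k"] by (simp add: E_uni_t_def)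
  then have "E_uni_i \<Omega> \<T> (s k) (\<Theta> (Suc k)) + 1 / (2 * \<tau>) * (H1_weighted_norm \<Omega> (\<lambda>x. (s k x)\<^sup>2) (t k))\<^sup>2
      \<le> E_uni_i \<Omega> \<T> (s k) (\<Theta> k)"
    using flow'[of k] flow'[of "Suc k"]
    by (intro director_step_energy_decay[OF acute \<sigma> \<kappa> s_fe, where n="n k" and n'="n (Suc k)" and E\<^sub>0=E\<^sub>0]
        pos small) auto
  moreover have "E_uni_t \<Omega> \<T> \<eta> \<psi> (s (Suc k)) (\<Theta> (Suc k)) +
      1 / \<tau> * (L2_norm_on \<Omega> (\<lambda>x. s (Suc k) x - s k x))\<^sup>2 \<le> E_uni_t \<Omega> \<T> \<eta> \<psi> (s k) (\<Theta> (Suc k))"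
    using flow'[of k] by (intro order_step_energy_decay[OF s _ acute pos(1) c e split]) auto
  moreover have "1 / (2 * \<tau>) * (L2_norm_on \<Omega> (\<lambda>x. s (Suc k) x - s k x))\<^sup>2
      \<le> 1 / \<tau> * (L2_norm_on \<Omega> (\<lambda>x. s (Suc k) x - s k x))\<^sup>2"
    using pos by (intro mult_right_mono) (auto simp: field_simps)
  ultimately show ?thesis
    by (simp only: E_uni_t_def E_uni_m_def distrib_left)
qed

end

text \<open>Otherwise every pair \<open>a (Suc k) + b k\<close> would contribute at least \<open>\<epsilon>\<close> to the bounded sums.\<close>

lemma dissipation_small_eventually:
  fixes a b :: "nat \<Rightarrow> real"
  assumes "\<And>k. a k \<ge> 0" "\<And>k. b k \<ge> 0" and bound: "\<And>K. (\<Sum>k<K. a k + b k) \<le> C" and "\<epsilon> > 0"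
  shows "\<exists>K\<ge>1. a K + b (K - 1) < \<epsilon>"
proof (rule ccontr)
  assume "\<not> ?thesis"
  then have low: "\<epsilon> \<le> a (Suc k) + b k" for k by (force simp: not_less)
  have "real m * \<epsilon> \<le> (\<Sum>k<Suc m. a k + b k)" for m
  proof -
    have "real m * \<epsilon> \<le> (\<Sum>k<m. a (Suc k) + b k)"
      using sum_mono[of "{..<m}" "\<lambda>_. \<epsilon>" "\<lambda>k. a (Suc k) + b k"] low by simp
    also have "\<dots> \<le> (\<Sum>k<Suc m. a k) + (\<Sum>k<Suc m. b k)"
      using assms(1)[of 0] assms(2)[of m]
      by (simp only: sum.lessThan_Suc_shift[of a] sum.lessThan_Suc[of b] sum.distrib)
    finally show ?thesis by (simp add: sum.distrib)
  qed
  then have "real m * \<epsilon> \<le> C" for m using bound[of "Suc m"] by (meson order_trans)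
  moreover obtain m where "real m * \<epsilon> > C" using reals_Archimedean3[OF \<open>\<epsilon> > 0\<close>] by blast
  ultimately show False by (meson not_le)
qed

text \<open>Squaring the bound on \<open>\<tau>\<close> and clearing the power of the energy leaves a product form that
  also covers vanishing energy, for which it holds with every \<open>\<tau>\<close>.\<close>

lemma time_step_condition_imp:
  fixes E h K \<tau> :: real
  assumes "K > 0" "h > 0" "\<tau> > 0" "E \<ge> 0"
    and "E > 0 \<Longrightarrow> \<tau> \<le> 1 / (5 * sqrt K) * E powr (- 1 / 2) * h powr (real d / 2)"
  shows "25 * K * (\<tau>\<^sup>2 * E) \<le> h ^ d"
proof (cases "E = 0")
  case False
  then have E: "E > 0" using \<open>E \<ge> 0\<close> by simp
  have "\<tau>\<^sup>2 \<le> (1 / (5 * sqrt K) * E powr (- 1 / 2) * h powr (real d / 2))\<^sup>2"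
    using assms(3,5) E by (intro power_mono) auto
  also have "\<dots> = 1 / (25 * K) * (E powr (- 1 / 2))\<^sup>2 * (h powr (real d / 2))\<^sup>2"
    using \<open>K > 0\<close> by (simp add: power_mult_distrib power_divide)
  also have "(E powr (- 1 / 2))\<^sup>2 = 1 / E"
    using E powr_add[of E "-1/2" "-1/2"] by (simp add: power2_eq_square powr_minus_divide)
  also have "(h powr (real d / 2))\<^sup>2 = h ^ d"
    using \<open>h > 0\<close> powr_add[of h "real d / 2" "real d / 2"] by (simp add: power2_eq_square powr_realpow)
  finally show ?thesis using E \<open>K > 0\<close> by (simp add: field_simps)
qed (use assms in auto)

section \<open>The energy law\<close>

context simplicial_mesh
begin

lemma E_uni_t_nonneg:
  assumes "weakly_acute \<Omega> \<T>" "\<eta> > 0" "\<And>r. \<psi> r \<ge> 0"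
  shows "0 \<le> E_uni_t \<Omega> \<T> \<eta> \<psi> s \<Theta>"
  using E_uni_m_nonneg[OF assms(1)] E_bulk_nonneg[OF assms(2,3)] by (simp add: E_uni_t_def)

text \<open>The smallness condition involves the initial energy, and stays sufficient in later steps
  because the energy has not increased up to then.\<close>

lemma gradient_flow_energy_law:
  assumes flow: "gradient_flow \<Omega> \<T> \<Gamma>\<^sub>s \<Gamma>\<^sub>\<Theta> \<tau> \<eta> \<psi>\<^sub>c \<psi>\<^sub>e g s \<Theta> n t" and s0: "s 0 \<in> fe_space_bc \<T> \<Gamma>\<^sub>s g"
    and acute: "weakly_acute \<Omega> \<T>" and \<sigma>: "shape_regular \<sigma> \<T>" and \<kappa>: "quasi_uniform \<kappa> \<T>"
    and pos: "\<eta> > 0" "\<tau> > 0"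
    and c: "convex_on UNIV \<psi>\<^sub>c" "\<And>r. \<psi>\<^sub>c differentiable (at r)"
    and e: "convex_on UNIV \<psi>\<^sub>e" "\<And>r. \<psi>\<^sub>e differentiable (at r)"
    and split: "\<And>r. \<psi> r = \<psi>\<^sub>c r - \<psi>\<^sub>e r" and \<psi>: "\<And>r. \<psi> r \<ge> 0"
    and small: "25 * inverse_constant TYPE('d) \<sigma> \<kappa> * (\<tau>\<^sup>2 * E_uni_t \<Omega> \<T> \<eta> \<psi> (s 0) (\<Theta> 0))
      \<le> mesh_size \<T> ^ CARD('d)"
  shows "E_uni_t \<Omega> \<T> \<eta> \<psi> (s K) (\<Theta> K) +
      1 / (2 * \<tau>) * (\<Sum>k<K. (H1_weighted_norm \<Omega> (\<lambda>x. (s k x)\<^sup>2) (t k))\<^sup>2 +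
        (L2_norm_on \<Omega> (\<lambda>x. s (Suc k) x - s k x))\<^sup>2)
    \<le> E_uni_t \<Omega> \<T> \<eta> \<psi> (s 0) (\<Theta> 0)"
proof (induction K)
  case (Suc K)
  have "0 \<le> 1 / (2 * \<tau>) * (\<Sum>k<K. (H1_weighted_norm \<Omega> (\<lambda>x. (s k x)\<^sup>2) (t k))\<^sup>2 +
        (L2_norm_on \<Omega> (\<lambda>x. s (Suc k) x - s k x))\<^sup>2)"
    using pos by (intro mult_nonneg_nonneg sum_nonneg) auto
  with Suc.IH have "E_uni_t \<Omega> \<T> \<eta> \<psi> (s K) (\<Theta> K) \<le> E_uni_t \<Omega> \<T> \<eta> \<psi> (s 0) (\<Theta> 0)"
    by linarith
  from gradient_flow_energy_step[OF flow s0 acute \<sigma> \<kappa> pos c e split \<psi> this small]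
  show ?case using Suc.IH by (simp only: sum.lessThan_Suc distrib_left)
qed simp

end

theorem theorem2:
  fixes \<sigma> \<kappa> :: real
  assumes "CARD('d::finite) \<ge> 2"
  shows "\<exists>c>0. \<forall>(\<Omega> :: (real^'d) set) \<T> \<Gamma>\<^sub>s \<Gamma>\<^sub>\<Theta> \<delta>\<^sub>0 g M R A B C K\<^sub>0 (e :: real^'d) \<psi> \<psi>\<^sub>c \<psi>\<^sub>e \<eta>\<^sub>B \<tau> s \<Theta> U\<^sub>0 n t.
     polyhedral_domain \<Omega> \<longrightarrow>
     conforming_mesh \<Omega> \<T> \<longrightarrow> shape_regular \<sigma> \<T> \<longrightarrow> quasi_uniform \<kappa> \<T> \<longrightarrow> weakly_acute \<Omega> \<T> \<longrightarrow>
     openin (top_of_set (frontier \<Omega>)) \<Gamma>\<^sub>s \<longrightarrow> openin (top_of_set (frontier \<Omega>)) \<Gamma>\<^sub>\<Theta> \<longrightarrow>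
     boundary_data \<Omega> \<delta>\<^sub>0 g M R \<longrightarrow>
     \<eta>\<^sub>B > 0 \<longrightarrow> A \<le> 0 \<longrightarrow> (CARD('d) = 2 \<longrightarrow> A < 0) \<longrightarrow> B > 0 \<longrightarrow> C > 0 \<longrightarrow>
     norm e = 1 \<longrightarrow> \<psi> = bulk_potential e A B C K\<^sub>0 \<longrightarrow> (\<forall>r. \<psi> r \<ge> 0) \<longrightarrow>
     (\<forall>r \<ge> 1 - \<delta>\<^sub>0. \<psi> r \<ge> \<psi> (1 - \<delta>\<^sub>0)) \<longrightarrow>
     (\<forall>r \<le> - 1 / (real CARD('d) - 1) + \<delta>\<^sub>0. \<psi> r \<ge> \<psi> (- 1 / (real CARD('d) - 1) + \<delta>\<^sub>0)) \<longrightarrow>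
     convex_on UNIV \<psi>\<^sub>c \<longrightarrow> convex_on UNIV \<psi>\<^sub>e \<longrightarrow>
     (\<forall>r. \<psi>\<^sub>c differentiable (at r)) \<longrightarrow> (\<forall>r. \<psi>\<^sub>e differentiable (at r)) \<longrightarrow>
     (\<forall>r. \<psi> r = \<psi>\<^sub>c r - \<psi>\<^sub>e r) \<longrightarrow>
     (s 0, \<Theta> 0, U\<^sub>0) \<in> admissible \<Omega> \<T> \<Gamma>\<^sub>s \<Gamma>\<^sub>\<Theta> (interp \<T> g) (interp \<T> M) (interp \<T> R) \<longrightarrow>
     gradient_flow \<Omega> \<T> \<Gamma>\<^sub>s \<Gamma>\<^sub>\<Theta> \<tau> \<eta>\<^sub>B \<psi>\<^sub>c \<psi>\<^sub>e (interp \<T> g) s \<Theta> n t \<longrightarrow>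
     \<tau> > 0 \<longrightarrow>
     (E_uni_t \<Omega> \<T> \<eta>\<^sub>B \<psi> (s 0) (\<Theta> 0) > 0 \<longrightarrow>
        \<tau> \<le> c * E_uni_t \<Omega> \<T> \<eta>\<^sub>B \<psi> (s 0) (\<Theta> 0) powr (- 1 / 2) * mesh_size \<T> powr (real CARD('d) / 2)) \<longrightarrow>
     (\<forall>K\<ge>1. E_uni_t \<Omega> \<T> \<eta>\<^sub>B \<psi> (s K) (\<Theta> K) +
        1 / (2 * \<tau>) * (\<Sum>k<K. (H1_weighted_norm \<Omega> (\<lambda>x. (s k x)\<^sup>2) (t k))\<^sup>2 +
           (L2_norm_on \<Omega> (\<lambda>x. s (Suc k) x - s k x))\<^sup>2)
        \<le> E_uni_t \<Omega> \<T> \<eta>\<^sub>B \<psi> (s 0) (\<Theta> 0)) \<and>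
     (\<forall>\<epsilon>>0. \<exists>K\<ge>1. 1 / \<tau> * ((H1_weighted_norm \<Omega> (\<lambda>x. (s K x)\<^sup>2) (t K))\<^sup>2 +
        (L2_norm_on \<Omega> (\<lambda>x. s K x - s (K - 1) x))\<^sup>2) < \<epsilon>)"
proof -
  let ?K = "inverse_constant TYPE('d) \<sigma> \<kappa>"
  \<comment> \<open>With this value, the bound on the time step squares to\n    \<open>25 * ?K * \<tau>\<^sup>2 * E\<^sub>0 \<le> h ^ d\<close>.  Meshes only exist for positive \<open>\<sigma>\<close> and \<open>\<kappa>\<close>; the value 1\n    otherwise is a default.\<close>
  define c where "c = (if \<sigma> > 0 \<and> \<kappa> > 0 then 1 / (5 * sqrt ?K) else 1)"
  have c_pos: "0 < c"
    using inverse_constant_pos[of \<sigma> \<kappa>, where 'd='d] by (simp add: c_def)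
  show ?thesis
  proof (rule exI[of _ c], intro conjI[OF c_pos] allI impI)
    fix \<Omega> :: "(real^'d) set" and \<T> \<Gamma>\<^sub>s \<Gamma>\<^sub>\<Theta> g M R \<psi> \<psi>\<^sub>c \<psi>\<^sub>e \<eta>\<^sub>B \<tau> s \<Theta> U\<^sub>0 n t
    assume mesh: "polyhedral_domain \<Omega>" "conforming_mesh \<Omega> \<T>"
      and \<sigma>: "shape_regular \<sigma> \<T>" and \<kappa>: "quasi_uniform \<kappa> \<T>" and acute: "weakly_acute \<Omega> \<T>"
      and pos: "\<eta>\<^sub>B > 0" "\<tau> > 0" and \<psi>: "\<forall>r. \<psi> r \<ge> 0"
      and convex: "convex_on UNIV \<psi>\<^sub>c" "convex_on UNIV \<psi>\<^sub>e"
      and diff: "\<forall>r. \<psi>\<^sub>c differentiable (at r)" "\<forall>r. \<psi>\<^sub>e differentiable (at r)"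
      and split: "\<forall>r. \<psi> r = \<psi>\<^sub>c r - \<psi>\<^sub>e r"
      and init: "(s 0, \<Theta> 0, U\<^sub>0) \<in> admissible \<Omega> \<T> \<Gamma>\<^sub>s \<Gamma>\<^sub>\<Theta> (interp \<T> g) (interp \<T> M) (interp \<T> R)"
      and flow: "gradient_flow \<Omega> \<T> \<Gamma>\<^sub>s \<Gamma>\<^sub>\<Theta> \<tau> \<eta>\<^sub>B \<psi>\<^sub>c \<psi>\<^sub>e (interp \<T> g) s \<Theta> n t"
      and step: "E_uni_t \<Omega> \<T> \<eta>\<^sub>B \<psi> (s 0) (\<Theta> 0) > 0 \<longrightarrow>
        \<tau> \<le> c * E_uni_t \<Omega> \<T> \<eta>\<^sub>B \<psi> (s 0) (\<Theta> 0) powr (- 1 / 2) * mesh_size \<T> powr (real CARD('d) / 2)"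
    interpret simplicial_mesh \<Omega> \<T> using mesh by unfold_locales
    define E where "E k = E_uni_t \<Omega> \<T> \<eta>\<^sub>B \<psi> (s k) (\<Theta> k)" for k
    define a where "a k = (H1_weighted_norm \<Omega> (\<lambda>x. (s k x)\<^sup>2) (t k))\<^sup>2" for k
    define b where "b k = (L2_norm_on \<Omega> (\<lambda>x. s (Suc k) x - s k x))\<^sup>2" for k
    have c: "c = 1 / (5 * sqrt ?K)" and K: "?K > 0"
      using shape_regular_pos[OF \<sigma>] quasi_uniform_pos[OF \<kappa>]
      by (simp_all add: c_def inverse_constant_pos)
    have nonneg: "0 \<le> E k" for k
      unfolding E_def using \<psi> by (intro E_uni_t_nonneg acute pos) simp
    have small: "25 * ?K * (\<tau>\<^sup>2 * E 0) \<le> mesh_size \<T> ^ CARD('d)"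
      using step nonneg[of 0] mesh_size_pos
      by (intro time_step_condition_imp K pos) (simp_all add: c E_def)
    have s0: "s 0 \<in> fe_space_bc \<T> \<Gamma>\<^sub>s (interp \<T> g)"
      using init by (simp add: admissible_def fe_space_bc_def)
    have law: "E K + 1 / (2 * \<tau>) * (\<Sum>k<K. a k + b k) \<le> E 0" for K
      unfolding E_def a_def b_def
      using \<psi> split diff
      by (intro gradient_flow_energy_law[OF flow s0 acute \<sigma> \<kappa> pos convex(1) _ convex(2)]
          small[unfolded E_def]) simp_all
    have "\<exists>K\<ge>1. 1 / \<tau> * ((H1_weighted_norm \<Omega> (\<lambda>x. (s K x)\<^sup>2) (t K))\<^sup>2 +
        (L2_norm_on \<Omega> (\<lambda>x. s K x - s (K - 1) x))\<^sup>2) < \<epsilon>" if "\<epsilon> > 0" for \<epsilon>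
    proof -
      have "(\<Sum>k<K. a k + b k) \<le> 2 * \<tau> * E 0" for K
      proof -
        have "1 / (2 * \<tau>) * (\<Sum>k<K. a k + b k) \<le> E 0" using law[of K] nonneg[of K] by linarith
        then show ?thesis using pos by (simp add: field_simps)
      qed
      then obtain K where "K \<ge> 1" "a K + b (K - 1) < \<tau> * \<epsilon>"
        using dissipation_small_eventually[of a b "2 * \<tau> * E 0" "\<tau> * \<epsilon>"] \<open>\<epsilon> > 0\<close> pos
        by (auto simp: a_def b_def)
      then show ?thesis
        using pos by (intro exI[of _ K]) (simp add: a_def b_def field_simps)
    qed
    then show "(\<forall>K\<ge>1. E_uni_t \<Omega> \<T> \<eta>\<^sub>B \<psi> (s K) (\<Theta> K) +
        1 / (2 * \<tau>) * (\<Sum>k<K. (H1_weighted_norm \<Omega> (\<lambda>x. (s k x)\<^sup>2) (t k))\<^sup>2 +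
           (L2_norm_on \<Omega> (\<lambda>x. s (Suc k) x - s k x))\<^sup>2)
        \<le> E_uni_t \<Omega> \<T> \<eta>\<^sub>B \<psi> (s 0) (\<Theta> 0)) \<and>
     (\<forall>\<epsilon>>0. \<exists>K\<ge>1. 1 / \<tau> * ((H1_weighted_norm \<Omega> (\<lambda>x. (s K x)\<^sup>2) (t K))\<^sup>2 +
        (L2_norm_on \<Omega> (\<lambda>x. s K x - s (K - 1) x))\<^sup>2) < \<epsilon>)"
      using law unfolding E_def a_def b_def by blast
  qed
qed

end
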